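(* Let $\lambda$ and $\lambda^s$ be the characters of $\mathbb{K}[\mathcal{NCP}]$ defined on noncrossing partitions $\pi$ by $$\lambda(\pi)=1,\qquad\lambda^s(\pi)=\begin{cases}1&\text{if }\pi=\mathrm{Base}(\pi),\\0&\text{otherwise.}\end{cases}$$ Then $$\Lambda=(\phi_{\mathcal{NCP}}\otimes\lambda)\circ\delta,\qquad\Lambda^s=(\phi_{\mathcal{NCP}}\otimes\lambda^s)\circ\delta.$$
   Context: $\mathbb{K}$ is a field of characteristic zero. A noncrossing partition is a partition $\pi$ of a set $[n]=\{1,\ldots,n\}$, $n\ge1$, into nonempty blocks such that there are no distinct blocks $b\ne b'$ and $x,z\in b$, $y,t\in b'$ with $x<y<z<t$. $|\pi|$ is its number of blocks; $\mathcal{NCP}$ is the set of all noncrossing partitions. For a nonempty set $Y$ of blocks of $\pi$, $\pi_{\mid Y}$ is the noncrossing partition obtained by deleting the blocks not in $Y$ and renumbering the remaining elements increasingly; $\pi_{\mid\emptyset}=1$. The nesting order on blocks is $b\le_\pi b'\iff b'\subseteq[\min b,\max b]$; $\mathrm{Base}(\pi)$ is the set of blocks minimal for $\le_\pi$. An ideal of $\pi$ is a set $J$ of blocks that is upward closed for $\le_\pi$; then the union of its blocks decomposes into maximal subsets of consecutive integers $I_1,\ldots,I_k$, each a union of blocks, and $\pi_{\mid_\cdot J}=\prod_i\pi_{\mid I_i}$ (restriction to the blocks contained in $I_i$; product $\cdot$ below). $\mathbb{K}[\mathcal{NCP}]$ is the free commutative algebra generated by $\mathcal{NCP}$, with product $\cdot$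 and unit $1$; a character is an algebra morphism to $\mathbb{K}$. It carries two coproducts which are algebra morphisms, given on $\pi\in\mathcal{NCP}$ by $\Delta(\pi)=\sum_{J\text{ ideal of }\pi}\pi_{\mid\pi\setminus J}\otimes\pi_{\mid_\cdot J}$ and $\delta(\pi)=\sum_{\sim\in\mathcal{E}_c[\pi]}\pi/\!\sim\,\otimes\,\pi\mid_\cdot\sim$, where, for an equivalence $\sim$ on the set of blocks of $\pi$, $\pi/\!\sim$ is the partition whose blocks are the unions of the blocks in each class, $\mathcal{E}_c[\pi]$ is the set of $\sim$ for which $\pi/\!\sim$ is noncrossing, and $\pi\mid_\cdot\sim=\prod_{C\text{ class of }\sim}\pi_{\mid C}$. The counits are the algebra morphisms with $\varepsilon_\Delta(\pi)=0$, and $\epsilon_\delta(\pi)=1$ if $|\pi|=1$, $\epsilon_\delta(\pi)=0$ otherwise. $\mathbb{K}[X]$ has the multiplicative coproducts $\Delta(X)=X\otimes1+1\otimes X$, $\delta(X)=X\otimes X$ with counits $P\mapsto P(0)$, $P\mapsto P(1)$. $\phi_{\mathcal{NCP}}:\mathbb{K}[\mathcal{NCP}]\to\mathbb{K}[X]$ is the unique algebra morphism compatible with both coproducts $\Delta,\delta$ and both counits. By known results it exists, is unique, and for $x\in\ker\varepsilon_\Delta$, $\phi_{\mathcal{NCP}}(x)=\sum_{k\ge1}\epsilon_\delta^{\otimes k}\circ\tilde\Delta^{(k-1)}(x)\,H_k(X)$, with $\tilde\Delta(x)=\Delta(x)-x\otimes1-1\otimes x$, $\tilde\Delta^{(k-1)}$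 its iterates ($\tilde\Delta^{(0)}=\mathrm{Id}$), and $H_k(X)=X(X-1)\cdots(X-k+1)/k!$. (In $(\phi_{\mathcal{NCP}}\otimes\lambda)\circ\delta$, $\mathbb{K}[X]\otimes\mathbb{K}$ is identified with $\mathbb{K}[X]$.) $\Lambda,\Lambda^s:\mathbb{K}[\mathcal{NCP}]\to\mathbb{K}[X]$ are the linear maps such that for every monomial $P=\pi_1\cdot\ldots\cdot\pi_k$ and every $n\ge1$, $\Lambda(P)(n)$ is the number of maps $f:\mathrm{Bl}(P)\to[n]$ with $b\le_Pb'\Rightarrow f(b)\le f(b')$, and $\Lambda^s(P)(n)$ is the number of maps $f:\mathrm{Bl}(P)\to[n]$ with ($b\le_Pb'$, $b\ne b'$) $\Rightarrow f(b)<f(b')$; here $\mathrm{Bl}(P)=\pi_1\sqcup\ldots\sqcup\pi_k$ is the disjoint union of the sets of blocks, ordered by $\le_P=\le_{\pi_1}\sqcup\ldots\sqcup\le_{\pi_k}$. They are bialgebra morphisms for $\Delta$. *)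

theory Defs
  imports
    "HOL-Library.Multiset"
    "HOL-Library.FuncSet"
    "HOL-Library.Disjoint_Sets"
    "HOL-Library.Product_Plus"
    "HOL-Library.Poly_Mapping"
    "HOL-Computational_Algebra.Polynomial"
begin

definition noncrossing :: "nat set set \<Rightarrow> bool" where
  "noncrossing P \<longleftrightarrow>
     \<not> (\<exists>b\<in>P. \<exists>b'\<in>P. b \<noteq> b' \<and>
          (\<exists>x\<in>b. \<exists>z\<in>b. \<exists>y\<in>b'. \<exists>t\<in>b'. x < y \<and> y < z \<and> z < t))"

typedef ncp = "{P :: nat set set. (\<exists>n\<ge>1. partition_on {1..n} P) \<and> noncrossing P}"
  morphisms blocks Abs_ncp
proof
  have "partition_on {1..1::nat} {{1}}"
    by (auto simp: partition_on_def disjoint_def)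
  moreover have "noncrossing {{1}}"
    by (auto simp: noncrossing_def)
  ultimately show "{{1}} \<in> {P :: nat set set. (\<exists>n\<ge>1. partition_on {1..n} P) \<and> noncrossing P}"
    by blast
qed

definition nest_le :: "nat set \<Rightarrow> nat set \<Rightarrow> bool" where
  "nest_le b b' \<longleftrightarrow> b' \<subseteq> {Min b..Max b}"

definition Base :: "ncp \<Rightarrow> nat set set" where
  "Base \<pi> = {b \<in> blocks \<pi>. \<forall>b'\<in>blocks \<pi>. nest_le b' b \<longrightarrow> b' = b}"

text \<open>The unique increasing bijection from \<open>\<Union>Y\<close> onto \<open>{1..card (\<Union>Y)}\<close>, applied to every block.\<close>

definition renumber :: "nat set set \<Rightarrow> nat set set" where
  "renumber Y = (\<lambda>b. (\<lambda>x. card {y \<in> \<Union>Y. y \<le> x}) ` b) ` Y"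

text \<open>
  A monomial in noncrossing partitions is a multiset; its unit is \<open>{#}\<close> and its product is \<open>+\<close>.
  Restrictions are monomials because the restriction to the empty set of blocks is the unit of
  the algebra, not a noncrossing partition.
\<close>

type_synonym ncp_mon = "ncp multiset"

definition restr :: "nat set set \<Rightarrow> ncp_mon" where
  "restr Y = (if Y = {} then {#} else {#Abs_ncp (renumber Y)#})"

definition ideals :: "ncp \<Rightarrow> nat set set set" where
  "ideals \<pi> = {J. J \<subseteq> blocks \<pi> \<and>
                  (\<forall>b\<in>J. \<forall>b'\<in>blocks \<pi>. nest_le b b' \<longrightarrow> b' \<in> J)}"

text \<open>The maximal subsets of consecutive integers of \<open>U\<close>.\<close>

definition runs :: "nat set \<Rightarrow> nat set set" where
  "runs U = {I. I \<noteq> {} \<and> I \<subseteq> U \<and> (\<exists>a c. I = {a..c}) \<and>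
                (\<forall>a c. I \<subseteq> {a..c} \<and> {a..c} \<subseteq> U \<longrightarrow> {a..c} = I)}"

definition dot_restr :: "ncp \<Rightarrow> nat set set \<Rightarrow> ncp_mon" where
  "dot_restr \<pi> J = (\<Sum>I\<in>runs (\<Union>J). restr {b \<in> blocks \<pi>. b \<subseteq> I})"

definition quot_blocks :: "ncp \<Rightarrow> (nat set \<times> nat set) set \<Rightarrow> nat set set" where
  "quot_blocks \<pi> E = \<Union> ` (blocks \<pi> // E)"

definition Ec :: "ncp \<Rightarrow> (nat set \<times> nat set) set set" where
  "Ec \<pi> = {E. equiv (blocks \<pi>) E \<and> noncrossing (quot_blocks \<pi> E)}"

definition dot_restr_equiv :: "ncp \<Rightarrow> (nat set \<times> nat set) set \<Rightarrow> ncp_mon" where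
  "dot_restr_equiv \<pi> E = (\<Sum>C\<in>blocks \<pi> // E. restr C)"

text \<open>
  The free commutative algebra on \<open>ncp\<close> is the monoid algebra of \<open>ncp_mon\<close>, with the convolution
  product of \<open>poly_mapping\<close>. Its tensor square is the monoid algebra of \<open>ncp_mon \<times> ncp_mon\<close>, where
  the pair \<open>(m, m')\<close> stands for the pure tensor of the monomials \<open>m\<close> and \<open>m'\<close>. In both, the scalar
  \<open>c\<close> is \<open>Poly_Mapping.single 0 c\<close>.
\<close>

type_synonym 'k ncp_alg = "ncp_mon \<Rightarrow>\<^sub>0 'k"
type_synonym 'k ncp_alg2 = "(ncp_mon \<times> ncp_mon) \<Rightarrow>\<^sub>0 'k"

definition mon :: "ncp_mon \<Rightarrow> 'k::field_char_0 ncp_alg" where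
  "mon m = Poly_Mapping.single m 1"

text \<open>
  The algebra morphism extending \<open>g\<close>, given on generators, into a commutative algebra with
  structure map \<open>s\<close>.
\<close>

definition alg_extend ::
  "('k::field_char_0 \<Rightarrow> 'b::comm_ring_1) \<Rightarrow> (ncp \<Rightarrow> 'b) \<Rightarrow> 'k ncp_alg \<Rightarrow> 'b" where
  "alg_extend s g x =
     (\<Sum>m\<in>Poly_Mapping.keys x. s (Poly_Mapping.lookup x m) * prod_mset (image_mset g m))"

definition ncp_Delta :: "'k::field_char_0 ncp_alg \<Rightarrow> 'k ncp_alg2" where
  "ncp_Delta = alg_extend (Poly_Mapping.single 0)
     (\<lambda>\<pi>. \<Sum>J\<in>ideals \<pi>. Poly_Mapping.single (restr (blocks \<pi> - J), dot_restr \<pi> J) 1)"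

definition ncp_delta :: "'k::field_char_0 ncp_alg \<Rightarrow> 'k ncp_alg2" where
  "ncp_delta = alg_extend (Poly_Mapping.single 0)
     (\<lambda>\<pi>. \<Sum>E\<in>Ec \<pi>. Poly_Mapping.single
            ({#Abs_ncp (quot_blocks \<pi> E)#}, dot_restr_equiv \<pi> E) 1)"

definition character :: "(ncp \<Rightarrow> 'k::field_char_0) \<Rightarrow> 'k ncp_alg \<Rightarrow> 'k" where
  "character g = alg_extend (\<lambda>c. c) g"

definition counit_Delta :: "'k::field_char_0 ncp_alg \<Rightarrow> 'k" where
  "counit_Delta = character (\<lambda>\<pi>. 0)"

definition counit_delta :: "'k::field_char_0 ncp_alg \<Rightarrow> 'k" where
  "counit_delta = character (\<lambda>\<pi>. if card (blocks \<pi>) = 1 then 1 else 0)"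

text \<open>
  The tensor square of the polynomial algebra is \<open>'k poly poly\<close>: the first tensor factor is the
  inner (coefficient) polynomial, the second one is the outer polynomial.
\<close>

definition poly_tensor :: "'k::field_char_0 poly \<Rightarrow> 'k poly \<Rightarrow> 'k poly poly" where
  "poly_tensor p q = smult p (map_poly (\<lambda>c. [:c:]) q)"

definition varX :: "'k::field_char_0 poly" where
  "varX = [:0, 1:]"

text \<open>The algebra morphism from polynomials to the tensor square sending the variable to \<open>t\<close>.\<close>

definition poly_subst2 :: "'k::field_char_0 poly poly \<Rightarrow> 'k poly \<Rightarrow> 'k poly poly" where
  "poly_subst2 t p = poly (map_poly (\<lambda>c. [:[:c:]:]) p) t"

definition poly_Delta :: "'k::field_char_0 poly \<Rightarrow> 'k poly poly" where
  "poly_Delta = poly_subst2 (poly_tensor varX 1 + poly_tensor 1 varX)"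

definition poly_delta :: "'k::field_char_0 poly \<Rightarrow> 'k poly poly" where
  "poly_delta = poly_subst2 (poly_tensor varX varX)"

definition alg_morphism :: "('k::field_char_0 ncp_alg \<Rightarrow> 'k poly) \<Rightarrow> bool" where
  "alg_morphism \<phi> \<longleftrightarrow>
     (\<forall>x y. \<phi> (x + y) = \<phi> x + \<phi> y) \<and>
     (\<forall>x y. \<phi> (x * y) = \<phi> x * \<phi> y) \<and>
     (\<forall>c. \<phi> (Poly_Mapping.single 0 c) = [:c:])"

text \<open>\<open>\<phi> \<otimes> \<psi>\<close> for linear \<open>\<phi>\<close> and \<open>\<psi>\<close>, computed on the basis of pure tensors of monomials.\<close>

definition tensor_map ::
  "('k::field_char_0 ncp_alg \<Rightarrow> 'k poly) \<Rightarrow> ('k ncp_alg \<Rightarrow> 'k poly) \<Rightarrow>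
   'k ncp_alg2 \<Rightarrow> 'k poly poly" where
  "tensor_map \<phi> \<psi> t =
     (\<Sum>(m, m')\<in>Poly_Mapping.keys t.
        smult [:Poly_Mapping.lookup t (m, m'):] (poly_tensor (\<phi> (mon m)) (\<psi> (mon m'))))"

text \<open>
  \<open>\<phi> \<otimes> \<mu>\<close> for linear \<open>\<phi>\<close> and a linear form \<open>\<mu>\<close>, with the tensor product of the polynomials
  and the field identified with the polynomials.
\<close>

definition tensor_form ::
  "('k::field_char_0 ncp_alg \<Rightarrow> 'k poly) \<Rightarrow> ('k ncp_alg \<Rightarrow> 'k) \<Rightarrow> 'k ncp_alg2 \<Rightarrow> 'k poly" where
  "tensor_form \<phi> \<mu> t =
     (\<Sum>(m, m')\<in>Poly_Mapping.keys t.
        smult (Poly_Mapping.lookup t (m, m') * \<mu> (mon m')) (\<phi> (mon m)))"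

definition double_bialgebra_morphism :: "('k::field_char_0 ncp_alg \<Rightarrow> 'k poly) \<Rightarrow> bool" where
  "double_bialgebra_morphism \<phi> \<longleftrightarrow>
     alg_morphism \<phi> \<and>
     (\<forall>x. poly_Delta (\<phi> x) = tensor_map \<phi> \<phi> (ncp_Delta x)) \<and>
     (\<forall>x. poly (\<phi> x) 0 = counit_Delta x) \<and>
     (\<forall>x. poly_delta (\<phi> x) = tensor_map \<phi> \<phi> (ncp_delta x)) \<and>
     (\<forall>x. poly (\<phi> x) 1 = counit_delta x)"

text \<open>
  The disjoint union of the sets of blocks of the factors of a monomial: \<open>(\<pi>, i, b)\<close> is the block
  \<open>b\<close> of the \<open>i\<close>-th copy of the factor \<open>\<pi>\<close>.
\<close>

definition Bl :: "ncp_mon \<Rightarrow> (ncp \<times> nat \<times> nat set) set" where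
  "Bl P = {(\<pi>, i, b). i < count P \<pi> \<and> b \<in> blocks \<pi>}"

definition Bl_le :: "ncp \<times> nat \<times> nat set \<Rightarrow> ncp \<times> nat \<times> nat set \<Rightarrow> bool" where
  "Bl_le = (\<lambda>(\<pi>, i, b) (\<pi>', i', b'). \<pi> = \<pi>' \<and> i = i' \<and> nest_le b b')"

definition weak_maps :: "ncp_mon \<Rightarrow> nat \<Rightarrow> (ncp \<times> nat \<times> nat set \<Rightarrow> nat) set" where
  "weak_maps P n = {f \<in> Bl P \<rightarrow>\<^sub>E {1..n}.
     \<forall>b\<in>Bl P. \<forall>b'\<in>Bl P. Bl_le b b' \<longrightarrow> f b \<le> f b'}"

definition strict_maps :: "ncp_mon \<Rightarrow> nat \<Rightarrow> (ncp \<times> nat \<times> nat set \<Rightarrow> nat) set" where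
  "strict_maps P n = {f \<in> Bl P \<rightarrow>\<^sub>E {1..n}.
     \<forall>b\<in>Bl P. \<forall>b'\<in>Bl P. Bl_le b b' \<and> b \<noteq> b' \<longrightarrow> f b < f b'}"

text \<open>The linear map sending every monomial to the polynomial interpolating \<open>c\<close> at all \<open>n \<ge> 1\<close>.\<close>

definition counting_map :: "(ncp_mon \<Rightarrow> nat \<Rightarrow> nat) \<Rightarrow> 'k::field_char_0 ncp_alg \<Rightarrow> 'k poly" where
  "counting_map c x =
     (\<Sum>P\<in>Poly_Mapping.keys x. smult (Poly_Mapping.lookup x P)
        (THE p. \<forall>n\<ge>1. poly p (of_nat n) = of_nat (c P n)))"

definition Lambda :: "'k::field_char_0 ncp_alg \<Rightarrow> 'k poly" where
  "Lambda = counting_map (\<lambda>P n. card (weak_maps P n))"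

definition Lambda_s :: "'k::field_char_0 ncp_alg \<Rightarrow> 'k poly" where
  "Lambda_s = counting_map (\<lambda>P n. card (strict_maps P n))"

definition lambda_char :: "'k::field_char_0 ncp_alg \<Rightarrow> 'k" where
  "lambda_char = character (\<lambda>\<pi>. 1)"

definition lambda_s_char :: "'k::field_char_0 ncp_alg \<Rightarrow> 'k" where
  "lambda_s_char = character (\<lambda>\<pi>. if blocks \<pi> = Base \<pi> then 1 else 0)"

end

theory Submission
  imports Defs
begin

text \<open>
  The idea is to read \<open>\<phi>\<close> as a counting polynomial too, and to obtain both identities from one
  way of sorting colourings of blocks.

  For a colouring \<open>f\<close> of the blocks of \<open>\<pi>\<close> by \<open>{1..n}\<close>, call two blocks linked if they have the
  same colour \<open>k\<close> and every block meeting the convex hull of their union has colour at least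
  \<open>k\<close>. A colouring is weakly monotone for nesting if and only if every block is linked to itself.
  Call it valid if every block is linked to itself and to no other block.

  The value of \<open>\<phi>\<close> at \<open>\<pi>\<close> and \<open>n\<close> is the number of valid colourings
  (\<open>poly_morphism_counts_valid_colourings\<close>): compatibility with \<open>\<Delta>\<close>, evaluated at \<open>n\<close> and \<open>1\<close>,
  expresses the value at \<open>n + 1\<close> as a sum over ideals \<open>J\<close>, in which the counit of \<open>\<delta>\<close> retains
  those \<open>J\<close> all of whose runs are single blocks. These are exactly the sets of blocks that a valid
  colouring can give the top colour \<open>n + 1\<close> (\<open>separated_ideals_iff_runs\<close>,
  \<open>card_valid_colourings_Suc\<close>).

  For a weakly monotone \<open>f\<close>, being linked is an equivalence relation \<open>E\<close> whose quotient is
  noncrossing (\<open>link_rel_in_Ec_iff\<close>), and \<open>f\<close> descends to a valid colouring of the quotient.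
  Conversely, pulling back a valid colouring of a noncrossing quotient \<open>\<pi>/E\<close> gives a weakly
  monotone colouring with link relation \<open>E\<close> (\<open>link_rel_eq_iff_valid_on_quotient\<close>). Summing over
  \<open>E\<close> gives the identity for \<open>\<Lambda>\<close> on a single partition. A weakly monotone colouring is strict
  exactly when no class of \<open>E\<close> contains two nested blocks (\<open>strict_iff_link_rel\<close>), which is what
  \<open>\<lambda>\<^sup>s\<close> detects; this gives the identity for \<open>\<Lambda>\<^sup>s\<close>. Both sides are multiplicative over the
  factors of a monomial and linear, and polynomials agreeing at all positive integers are equal.
\<close>

section \<open>Linear extension from monomials and evaluation\<close>

text \<open>
  Characters, coproducts and tensor maps are all sums over the support of their argument, with
  values in different rings into which the scalars embed. Working with an arbitrary embedding \<open>s\<close> gives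
  linearity and multiplicativity of all of them at once.
\<close>
locale scalar_hom =
  fixes s :: "'k::field_char_0 \<Rightarrow> 'b::comm_ring_1"
  assumes add: "s (a + b) = s a + s b"
    and mult: "s (a * b) = s a * s b"
    and one: "s 1 = 1"
begin

lemma zero: "s 0 = 0"
  using add[of 0 0] by simp

definition lin_ext :: "('m \<Rightarrow> 'b) \<Rightarrow> ('m \<Rightarrow>\<^sub>0 'k) \<Rightarrow> 'b" where
  "lin_ext h x = (\<Sum>k\<in>Poly_Mapping.keys x. s (Poly_Mapping.lookup x k) * h k)"

lemma lin_ext_superset:
  assumes "finite A" "Poly_Mapping.keys x \<subseteq> A"
  shows "lin_ext h x = (\<Sum>k\<in>A. s (Poly_Mapping.lookup x k) * h k)"
  unfolding lin_ext_def
  by (rule sum.mono_neutral_left) (use assms in \<open>auto simp: zero in_keys_iff\<close>)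

lemma lin_ext_zero [simp]: "lin_ext h 0 = 0"
  by (simp add: lin_ext_def)

lemma lin_ext_single: "lin_ext h (Poly_Mapping.single k c) = s c * h k"
  by (simp add: lin_ext_def zero)

lemma lin_ext_add: "lin_ext h (x + y) = lin_ext h x + lin_ext h y"
proof -
  let ?A = "Poly_Mapping.keys x \<union> Poly_Mapping.keys y"
  have "lin_ext h z = (\<Sum>k\<in>?A. s (Poly_Mapping.lookup z k) * h k)" if "z \<in> {x, y, x + y}" for z
    using that keys_add[of x y] by (intro lin_ext_superset) auto
  then show ?thesis
    by (simp add: lookup_add add distrib_right sum.distrib)
qed

lemma lin_ext_sum: "lin_ext h (\<Sum>i\<in>A. x i) = (\<Sum>i\<in>A. lin_ext h (x i))"
  by (induction A rule: infinite_finite_induct) (auto simp: lin_ext_add)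

lemma lin_ext_mult:
  fixes x y :: "'m::comm_monoid_add \<Rightarrow>\<^sub>0 'k"
  assumes h: "\<And>a b. h (a + b) = h a * h b"
  shows "lin_ext h (x * y) = lin_ext h x * lin_ext h y"
proof -
  \<comment> \<open>Both factors are sums of monomials, on which multiplicativity is the hypothesis on \<open>h\<close>.\<close>
  have expand: "z = (\<Sum>k\<in>Poly_Mapping.keys z. Poly_Mapping.single k (Poly_Mapping.lookup z k))"
    for z :: "'m \<Rightarrow>\<^sub>0 'k"
    by (rule poly_mapping_eqI) (simp add: lookup_sum lookup_single when_def in_keys_iff)
  have "lin_ext h (x * y) = lin_ext h
     ((\<Sum>k\<in>Poly_Mapping.keys x. Poly_Mapping.single k (Poly_Mapping.lookup x k)) *
      (\<Sum>k\<in>Poly_Mapping.keys y. Poly_Mapping.single k (Poly_Mapping.lookup y k)))"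
    using expand by metis
  also have "\<dots> = lin_ext h x * lin_ext h y"
    by (simp add: sum_product mult_single lin_ext_sum lin_ext_single h mult ac_simps)
       (simp add: lin_ext_def sum_product ac_simps)
  finally show ?thesis .
qed

lemma lin_ext_prod_mset:
  fixes g :: "'a \<Rightarrow> 'm::comm_monoid_add \<Rightarrow>\<^sub>0 'k"
  assumes "\<And>a b. h (a + b) = h a * h b" "h 0 = 1"
  shows "lin_ext h (\<Prod>i\<in>#M. g i) = (\<Prod>i\<in>#M. lin_ext h (g i))"
proof (induction M)
  case empty
  show ?case using lin_ext_single[of h 0 1] by (simp add: assms one)
qed (simp add: lin_ext_mult assms)

lemma alg_extend_conv: "alg_extend s g = lin_ext (\<lambda>m. \<Prod>\<pi>\<in>#m. g \<pi>)"
  by (simp add: fun_eq_iff alg_extend_def lin_ext_def)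

lemma alg_extend_mon: "alg_extend s g (mon m) = (\<Prod>\<pi>\<in>#m. g \<pi>)"
  by (simp add: alg_extend_conv mon_def lin_ext_single one)

end

interpretation scal_alg: scalar_hom "Poly_Mapping.single (0::'m::comm_monoid_add)"
  by unfold_locales (simp_all add: single_add mult_single)

interpretation scal_id: scalar_hom "\<lambda>c. c"
  by unfold_locales simp_all

interpretation scal_poly: scalar_hom "\<lambda>c. [:c:]"
  by unfold_locales (simp_all add: one_pCons)

interpretation scal_poly2: scalar_hom "\<lambda>c. [:[:c:]:]"
  by unfold_locales (simp_all add: one_pCons)

lemma tensor_form_conv:
  "tensor_form \<phi> \<mu> = scal_poly.lin_ext (\<lambda>k. smult (\<mu> (mon (snd k))) (\<phi> (mon (fst k))))"
  by (simp add: fun_eq_iff tensor_form_def scal_poly.lin_ext_def case_prod_beta mult.commute)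

lemma tensor_map_conv:
  "tensor_map \<phi> \<psi> = scal_poly2.lin_ext (\<lambda>k. poly_tensor (\<phi> (mon (fst k))) (\<psi> (mon (snd k))))"
  by (simp add: fun_eq_iff tensor_map_def scal_poly2.lin_ext_def case_prod_beta)

lemma character_mon: "character g (mon m) = (\<Prod>\<pi>\<in>#m. g \<pi>)"
  by (simp add: character_def scal_id.alg_extend_mon)

lemma mon_add: "mon (a + b) = mon a * mon b"
  by (simp add: mon_def mult_single)

lemma alg_morphism_mon:
  assumes "alg_morphism \<phi>"
  shows "\<phi> (mon {#}) = 1" "\<phi> (mon (a + b)) = \<phi> (mon a) * \<phi> (mon b)"
proof -
  have "\<phi> (Poly_Mapping.single 0 1) = [:1:]"
    using assms by (simp only: alg_morphism_def)
  then show "\<phi> (mon {#}) = 1"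
    by (simp add: mon_def one_pCons)
  show "\<phi> (mon (a + b)) = \<phi> (mon a) * \<phi> (mon b)"
    using assms by (simp add: mon_add alg_morphism_def)
qed

text \<open>
  Tensoring an algebra morphism with a character gives an algebra morphism, because the tensor
  square is itself a monoid algebra on which the integrand is multiplicative. So the composite
  with \<open>\<delta>\<close> is determined by its values on single partitions.
\<close>
lemma tensor_form_ncp_delta:
  fixes \<phi> :: "'k::field_char_0 ncp_alg \<Rightarrow> 'k poly" and g :: "ncp \<Rightarrow> 'k"
  assumes \<phi>: "alg_morphism \<phi>"
  shows "tensor_form \<phi> (character g) (ncp_delta x) =
    (\<Sum>m\<in>Poly_Mapping.keys x. smult (Poly_Mapping.lookup x m)
       (\<Prod>\<pi>\<in>#m. \<Sum>E\<in>Ec \<pi>. smult (\<Prod>\<rho>\<in>#dot_restr_equiv \<pi> E. g \<rho>)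
          (\<phi> (mon {#Abs_ncp (quot_blocks \<pi> E)#}))))"
proof -
  define h where "h = (\<lambda>k. smult (character g (mon (snd k))) (\<phi> (mon (fst k))))"
  have h_add: "h (a + b) = h a * h b" for a b
    by (simp add: h_def alg_morphism_mon[OF \<phi>] character_mon ac_simps)
  have h_0: "h 0 = 1"
    by (simp add: h_def alg_morphism_mon[OF \<phi>] character_mon)
  show ?thesis
    unfolding tensor_form_conv h_def[symmetric] ncp_delta_def alg_extend_def
    by (simp add: scal_poly.lin_ext_sum scal_poly.lin_ext_mult[OF h_add] scal_poly.lin_ext_single
        scal_poly.lin_ext_prod_mset[OF h_add h_0] h_0)
       (simp add: h_def character_mon)
qed

text \<open>
  A coproduct identity for polynomials becomes numerical by evaluating the outer variable at a
  constant polynomial and then the inner variable; for the first coproduct this yields \<open>p (x + y)\<close>.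
\<close>
lemma poly_poly_subst2:
  "poly (poly (poly_subst2 t p) [:y:]) x = poly p (poly (poly t [:y:]) x)"
  unfolding poly_subst2_def
  by (induction p) (simp_all add: map_poly_pCons)

lemma poly_map_poly_const: "poly (map_poly (\<lambda>c. [:c:]) q) [:y:] = [:poly q y:]"
  by (induction q) (simp_all add: map_poly_pCons mult.commute)

lemma poly_poly_tensor: "poly (poly (poly_tensor p q) [:y:]) x = poly p x * poly q y"
  by (simp add: poly_tensor_def poly_map_poly_const)

lemma poly_poly_Delta: "poly (poly (poly_Delta p) [:y:]) x = poly p (x + y)"
  by (simp add: poly_Delta_def poly_poly_subst2 poly_poly_tensor varX_def)

lemma poly_eval_sum_Delta:
  fixes \<phi> :: "'k::field_char_0 ncp_alg \<Rightarrow> 'k poly"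
  assumes "\<And>x. poly_Delta (\<phi> x) = tensor_map \<phi> \<phi> (ncp_Delta x)"
  shows "poly (\<phi> (mon {#\<pi>#})) (u + v) =
    (\<Sum>J\<in>ideals \<pi>. poly (\<phi> (mon (restr (blocks \<pi> - J)))) u * poly (\<phi> (mon (dot_restr \<pi> J))) v)"
proof -
  have "poly (\<phi> (mon {#\<pi>#})) (u + v) =
    poly (poly (tensor_map \<phi> \<phi> (ncp_Delta (mon {#\<pi>#}))) [:v:]) u"
    by (simp add: assms[symmetric] poly_poly_Delta)
  then show ?thesis
    by (simp add: ncp_Delta_def scal_alg.alg_extend_mon tensor_map_conv scal_poly2.lin_ext_sum
        scal_poly2.lin_ext_single poly_sum poly_poly_tensor)
qed

lemma poly_eq_from_positive_naturals:
  fixes p q :: "'k::field_char_0 poly"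
  assumes "\<And>n. n \<ge> 1 \<Longrightarrow> poly p (of_nat n) = poly q (of_nat n)"
  shows "p = q"
proof (rule ccontr)
  assume "p \<noteq> q"
  then have "finite {x. poly (p - q) x = 0}"
    by (intro poly_roots_finite) simp
  moreover have "of_nat ` {1..} \<subseteq> {x. poly (p - q) x = 0}"
    using assms by auto
  ultimately have "finite (of_nat ` {1..} :: 'k set)"
    by (rule finite_subset[rotated])
  then show False
    by (simp add: finite_image_iff inj_on_def infinite_Ici)
qed

text \<open>
  A polynomial with the right values at the positive integers is the interpolating polynomial
  chosen by the definite description, since a field of characteristic zero contains infinitely
  many such integers.
\<close>
lemma counting_map_eqI:
  fixes x :: "'k::field_char_0 ncp_alg"
  assumes "\<And>P n. n \<ge> 1 \<Longrightarrow> poly (q P) (of_nat n) = of_nat (c P n)"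
  shows "counting_map c x =
    (\<Sum>P\<in>Poly_Mapping.keys x. smult (Poly_Mapping.lookup x P) (q P))"
proof -
  have "(THE p. \<forall>n\<ge>1. poly p (of_nat n) = (of_nat (c P n) :: 'k)) = q P" for P
    using assms by (intro the_equality poly_eq_from_positive_naturals) auto
  then show ?thesis
    by (simp add: counting_map_def)
qed

section \<open>Linked blocks and valid colourings\<close>

text \<open>
  Some element of \<open>c\<close> lies in the convex hull of \<open>A\<close>. This form uses only the order of
  the elements involved, so it is visibly preserved by increasing renumberings; on the blocks of a
  noncrossing partition it coincides with nesting.
\<close>
definition straddled :: "nat set \<Rightarrow> nat set \<Rightarrow> bool" where
  "straddled c A \<longleftrightarrow> (\<exists>y\<in>c. \<exists>x\<in>A. \<exists>z\<in>A. x \<le> y \<and> y \<le> z)"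

text \<open>
  Two blocks are linked if they share a colour \<open>k\<close> and lie in the same run of consecutive
  elements of colour at least \<open>k\<close>. Reflexivity of this relation is not automatic: for a
  noncrossing partition it says exactly that colours weakly increase under nesting.
\<close>
definition linked :: "nat set set \<Rightarrow> (nat set \<Rightarrow> nat) \<Rightarrow> nat set \<Rightarrow> nat set \<Rightarrow> bool" where
  "linked Y f b b' \<longleftrightarrow> f b = f b' \<and> (\<forall>c\<in>Y. straddled c (b \<union> b') \<longrightarrow> f b \<le> f c)"

text \<open>
  The right-to-left implication demands monotonicity under nesting; the other one demands that
  in the runs of colours at least \<open>k\<close> no two blocks have colour \<open>k\<close>.
\<close>
definition valid_colourings :: "nat set set \<Rightarrow> nat \<Rightarrow> (nat set \<Rightarrow> nat) set" where
  "valid_colourings Y n =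
     {f \<in> Y \<rightarrow>\<^sub>E {1..n}. \<forall>b\<in>Y. \<forall>b'\<in>Y. linked Y f b b' \<longleftrightarrow> b = b'}"

text \<open>
  For noncrossing partitions these are the ideals whose runs are single blocks; they are what
  the counit of \<open>\<delta>\<close> leaves of the first coproduct. The formulation is that of
  \<open>linked\<close> for a maximal colour taken precisely on \<open>J\<close>.
\<close>
definition separated_ideals :: "nat set set \<Rightarrow> nat set set set" where
  "separated_ideals Y =
     {J. J \<subseteq> Y \<and> (\<forall>b\<in>J. \<forall>b'\<in>J. (\<forall>c\<in>Y. straddled c (b \<union> b') \<longrightarrow> c \<in> J) \<longleftrightarrow> b = b')}"

lemma straddled_mono: "straddled c A \<Longrightarrow> A \<subseteq> B \<Longrightarrow> straddled c B"
  unfolding straddled_def by blast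

text \<open>
  Any element \<open>w\<close> of \<open>B\<close> splits the hull of \<open>A \<union> C\<close> into parts
  left and right of \<open>w\<close>, each lying in one of the two smaller hulls. This is what makes linking
  transitive.
\<close>
lemma straddled_split:
  assumes "straddled c (A \<union> C)" "B \<noteq> {}"
  shows "straddled c (A \<union> B) \<or> straddled c (B \<union> C)"
proof -
  obtain y x z where y: "y \<in> c" and xz: "x \<in> A \<union> C" "z \<in> A \<union> C" "x \<le> y" "y \<le> z"
    using assms(1) unfolding straddled_def by blast
  obtain w where w: "w \<in> B" using assms(2) by blast
  show ?thesis
  proof (cases "y \<le> w")
    case True
    then show ?thesis using xz y w unfolding straddled_def by blast
  next
    case False
    then have "w \<le> y" by simp
    then show ?thesis using xz y w unfolding straddled_def by blast
  qed
qed

lemma linked_sym: "linked Y f b b' \<Longrightarrow> linked Y f b' b"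
  unfolding linked_def by (metis Un_commute)

lemma linked_trans:
  assumes "linked Y f b b'" "linked Y f b' b''" "b' \<noteq> {}"
  shows "linked Y f b b''"
  using assms straddled_split[of _ b b'' b'] unfolding linked_def by metis

lemma valid_colourings_empty: "valid_colourings {} n = {\<lambda>_. undefined}"
  by (auto simp: valid_colourings_def)

lemma valid_colourings_zero: "Y \<noteq> {} \<Longrightarrow> valid_colourings Y 0 = {}"
  by (auto simp: valid_colourings_def PiE_eq_empty_iff)

lemma finite_valid_colourings: "finite Y \<Longrightarrow> finite (valid_colourings Y n)"
  unfolding valid_colourings_def by (rule finite_subset[of _ "Y \<rightarrow>\<^sub>E {1..n}"]) (auto intro: finite_PiE)

text \<open>
  The recursion comes from removing the blocks \<open>J\<close> of maximal colour \<open>n + 1\<close>. Such blocks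
  never obstruct a link between the remaining ones, so the rest of the colouring is constrained
  only by itself; and the condition on links inside \<open>J\<close> is that \<open>J\<close> is separated.
\<close>
lemma card_valid_colourings_Suc:
  assumes "finite Y"
  shows "card (valid_colourings Y (Suc n)) = (\<Sum>J\<in>separated_ideals Y. card (valid_colourings (Y - J) n))"
proof -
  define top where "top = (\<lambda>f::nat set \<Rightarrow> nat. {b \<in> Y. f b = Suc n})"
  have fin: "finite (separated_ideals Y)"
    unfolding separated_ideals_def using assms by auto
  have top_in: "top f \<in> separated_ideals Y" if f: "f \<in> valid_colourings Y (Suc n)" for f
  proof -
    have le: "f b \<le> Suc n" if "b \<in> Y" for b
      using f that by (auto simp: valid_colourings_def PiE_def Pi_def)
    have eq: "linked Y f b b' \<longleftrightarrow> b = b'" if "b \<in> Y" "b' \<in> Y" for b b'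
      using f that by (auto simp: valid_colourings_def)
    have "(\<forall>c\<in>Y. straddled c (b \<union> b') \<longrightarrow> c \<in> top f) \<longleftrightarrow> b = b'"
      if b: "b \<in> top f" "b' \<in> top f" for b b'
    proof -
      have "f c = Suc n \<longleftrightarrow> Suc n \<le> f c" if "c \<in> Y" for c
        using le[OF that] by auto
      then have "(\<forall>c\<in>Y. straddled c (b \<union> b') \<longrightarrow> c \<in> top f) \<longleftrightarrow> linked Y f b b'"
        using b by (auto simp: linked_def top_def)
      then show ?thesis
        using eq[of b b'] b by (auto simp: top_def)
    qed
    then show ?thesis
      by (auto simp: separated_ideals_def) (auto simp: top_def)
  qed
  have fibre: "card {f \<in> valid_colourings Y (Suc n). top f = J} = card (valid_colourings (Y - J) n)"
    if J: "J \<in> separated_ideals Y" for J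
  proof -
    define ext where "ext = (\<lambda>g b. if b \<in> J then Suc n else (g b :: nat))"
    have JY: "J \<subseteq> Y"
      using J by (simp add: separated_ideals_def)
    have J_iff: "(\<forall>c\<in>Y. straddled c (b \<union> b') \<longrightarrow> c \<in> J) \<longleftrightarrow> b = b'" if "b \<in> J" "b' \<in> J" for b b'
      using J that by (simp add: separated_ideals_def)
    \<comment> \<open>Blocks of maximal colour satisfy every lower bound on colours, so they cannot affect links.\<close>
    have link_low: "linked Y f b b' \<longleftrightarrow> linked (Y - J) f b b'"
      if "b \<in> Y - J" "f b \<le> n" "\<And>c. c \<in> J \<Longrightarrow> f c = Suc n" for f b b'
    proof -
      have "f b \<le> f c" if "c \<in> J" for c
        using that \<open>f b \<le> n\<close> \<open>\<And>c. c \<in> J \<Longrightarrow> f c = Suc n\<close>[of c] by simp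
      then show ?thesis
        unfolding linked_def by blast
    qed
    have "bij_betw ext (valid_colourings (Y - J) n) {f \<in> valid_colourings Y (Suc n). top f = J}"
    proof (rule bij_betw_byWitness[where f' = "\<lambda>f. restrict f (Y - J)"])
      show "\<forall>g\<in>valid_colourings (Y - J) n. restrict (ext g) (Y - J) = g"
        by (auto simp: fun_eq_iff ext_def valid_colourings_def PiE_def extensional_def)
      show "\<forall>f\<in>{f \<in> valid_colourings Y (Suc n). top f = J}. ext (restrict f (Y - J)) = f"
        using JY by (auto simp: fun_eq_iff ext_def top_def valid_colourings_def PiE_def extensional_def restrict_def)
      show "ext ` valid_colourings (Y - J) n \<subseteq> {f \<in> valid_colourings Y (Suc n). top f = J}"
      proof (intro image_subsetI CollectI conjI)
        fix g assume g: "g \<in> valid_colourings (Y - J) n"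
        then have gE: "g \<in> (Y - J) \<rightarrow>\<^sub>E {1..n}"
          and gv: "\<And>b b'. b \<in> Y - J \<Longrightarrow> b' \<in> Y - J \<Longrightarrow> linked (Y - J) g b b' \<longleftrightarrow> b = b'"
          by (auto simp: valid_colourings_def)
        have low: "ext g b \<le> n" "1 \<le> ext g b" "ext g b = g b" if "b \<in> Y - J" for b
          using gE that by (auto simp: ext_def PiE_def Pi_def)
        have high: "ext g b = Suc n" if "b \<in> J" for b
          using that by (simp add: ext_def)
        show "top (ext g) = J"
          using low high JY by (force simp: top_def)
        have E: "ext g \<in> Y \<rightarrow>\<^sub>E {1..Suc n}"
        proof (rule PiE_I)
          show "ext g b \<in> {1..Suc n}" if "b \<in> Y" for b
            using that low[of b] high[of b] by (cases "b \<in> J") auto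
          show "ext g b = undefined" if "b \<notin> Y" for b
            using that JY gE by (auto simp: ext_def PiE_def extensional_def)
        qed
        have "linked Y (ext g) b b' \<longleftrightarrow> b = b'" if b: "b \<in> Y" "b' \<in> Y" for b b'
        proof -
          consider "b \<in> J" "b' \<in> J" | "b \<in> J" "b' \<notin> J" | "b \<notin> J" "b' \<in> J" | "b \<notin> J" "b' \<notin> J"
            by blast
          then show ?thesis
          proof cases
            case 1
            have "Suc n \<le> ext g c \<longleftrightarrow> c \<in> J" if "c \<in> Y" for c
              using low[of c] high[of c] that by force
            then show ?thesis
              using J_iff[OF 1] high[OF 1(1)] high[OF 1(2)] by (auto simp: linked_def)
          next
            case 2
            then show ?thesis using high[of b] low[of b'] b by (auto simp: linked_def)
          next
            case 3
            then show ?thesis using high[of b'] low[of b] b by (auto simp: linked_def)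
          next
            case 4
            have "linked (Y - J) (ext g) b b' \<longleftrightarrow> linked (Y - J) g b b'"
              using 4 b low by (auto simp: linked_def)
            then show ?thesis
              using gv[of b b'] link_low[of b "ext g" b'] low[of b] high 4 b by auto
          qed
        qed
        then show "ext g \<in> valid_colourings Y (Suc n)"
          using E by (simp add: valid_colourings_def)
      qed
      show "(\<lambda>f. restrict f (Y - J)) ` {f \<in> valid_colourings Y (Suc n). top f = J}
        \<subseteq> valid_colourings (Y - J) n"
      proof safe
        fix f assume f: "f \<in> valid_colourings Y (Suc n)" and J_def: "J = top f"
        have fv: "linked Y f b b' \<longleftrightarrow> b = b'" if "b \<in> Y" "b' \<in> Y" for b b'
          using f that by (auto simp: valid_colourings_def)
        have fE: "1 \<le> f b" "f b \<le> Suc n" if "b \<in> Y" for b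
          using f that by (auto simp: valid_colourings_def PiE_def Pi_def)
        have low: "1 \<le> f b" "f b \<le> n" if "b \<in> Y - J" for b
          using fE[of b] that unfolding J_def top_def by auto
        have high: "f c = Suc n" if "c \<in> J" for c
          using that by (simp add: J_def top_def)
        have "linked (Y - J) (restrict f (Y - J)) b b' \<longleftrightarrow> b = b'" if "b \<in> Y - J" "b' \<in> Y - J" for b b'
        proof -
          have "linked (Y - J) (restrict f (Y - J)) b b' \<longleftrightarrow> linked (Y - J) f b b'"
            using that by (auto simp: linked_def)
          then show ?thesis
            using link_low[of b f b'] low[of b] high that fv[of b b'] by auto
        qed
        moreover have "restrict f (Y - J) \<in> (Y - J) \<rightarrow>\<^sub>E {1..n}"
          using low by auto
        ultimately show "restrict f (Y - top f) \<in> valid_colourings (Y - top f) n"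
          unfolding valid_colourings_def J_def by auto
      qed
    qed
    then show ?thesis
      using bij_betw_same_card by metis
  qed
  have "card (valid_colourings Y (Suc n)) =
      card (\<Union>J\<in>separated_ideals Y. {f \<in> valid_colourings Y (Suc n). top f = J})"
    by (rule arg_cong[where f = card]) (use top_in in auto)
  also have "\<dots> = (\<Sum>J\<in>separated_ideals Y. card {f \<in> valid_colourings Y (Suc n). top f = J})"
    by (rule card_UN_disjoint) (use fin assms in \<open>auto intro: finite_subset[OF _ finite_valid_colourings]\<close>)
  finally show ?thesis
    using fibre by simp
qed

section \<open>Nesting, renumbering and ideals of noncrossing partitions\<close>

lemma blocks_ncp:
  obtains n where "n \<ge> 1" "partition_on {1..n} (blocks \<pi>)" "noncrossing (blocks \<pi>)"
  using blocks[of \<pi>] by auto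

lemma noncrossingD:
  assumes "noncrossing P" "b \<in> P" "b' \<in> P" "b \<noteq> b'" "x \<in> b" "z \<in> b" "y \<in> b'" "t \<in> b'"
    "x < y" "y < z" "z < t"
  shows False
  using assms unfolding noncrossing_def by meson

lemma noncrossing_blocks: "noncrossing (blocks \<pi>)"
  using blocks[of \<pi>] by auto

lemma disjoint_blocks: "b \<in> blocks \<pi> \<Longrightarrow> b' \<in> blocks \<pi> \<Longrightarrow> b \<noteq> b' \<Longrightarrow> b \<inter> b' = {}"
  by (rule blocks_ncp[of \<pi>]) (metis disjointD partition_onD2)

lemma finite_blocks: "finite (blocks \<pi>)"
  by (rule blocks_ncp[of \<pi>]) (auto intro: finite_elements)

lemma blocks_nonempty: "blocks \<pi> \<noteq> {}"
  by (rule blocks_ncp[of \<pi>]) (auto simp: partition_on_def)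

lemma block_finite_nonempty:
  assumes "b \<in> blocks \<pi>" shows "finite b" "b \<noteq> {}"
proof -
  obtain n where n: "partition_on {1..n} (blocks \<pi>)"
    by (rule blocks_ncp)
  then have "b \<subseteq> {1..n}" using assms partition_onD1 by fastforce
  then show "finite b" by (rule finite_subset) simp
  show "b \<noteq> {}" using n assms partition_onD3 by fastforce
qed

lemma in_block_between:
  assumes "x \<in> \<Union> (blocks \<pi>)" "z \<in> \<Union> (blocks \<pi>)" "x \<le> y" "y \<le> z"
  shows "y \<in> \<Union> (blocks \<pi>)"
proof -
  obtain n where "partition_on {1..n} (blocks \<pi>)"
    by (rule blocks_ncp)
  then have "\<Union> (blocks \<pi>) = {1..n}" by (rule partition_onD1[symmetric])
  then show ?thesis using assms by auto
qed

lemma nest_le_iff: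
  assumes "finite b" "b \<noteq> {}"
  shows "nest_le b b' \<longleftrightarrow> (\<forall>y\<in>b'. straddled {y} b)"
proof
  assume "nest_le b b'"
  then show "\<forall>y\<in>b'. straddled {y} b"
    using Min_in[OF assms] Max_in[OF assms] unfolding nest_le_def straddled_def by fastforce
next
  assume "\<forall>y\<in>b'. straddled {y} b"
  then have "\<exists>x\<in>b. \<exists>z\<in>b. x \<le> y \<and> y \<le> z" if "y \<in> b'" for y
    using that by (simp add: straddled_def)
  then have "Min b \<le> y \<and> y \<le> Max b" if "y \<in> b'" for y
    using that Min_le[OF assms(1)] Max_ge[OF assms(1)] order_trans by meson
  then show "nest_le b b'"
    by (auto simp: nest_le_def)
qed

text \<open>
  In a noncrossing partition a block with at least one element in the hull of another block
  lies in that hull entirely: an element outside would produce a crossing.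
\<close>
lemma nest_le_iff_straddled:
  assumes "b \<in> blocks \<pi>" "c \<in> blocks \<pi>"
  shows "nest_le b c \<longleftrightarrow> straddled c b"
proof
  assume "nest_le b c"
  then show "straddled c b"
    using nest_le_iff[of b c] block_finite_nonempty[of _ \<pi>] assms unfolding straddled_def by blast
next
  assume s: "straddled c b"
  show "nest_le b c"
  proof (cases "b = c")
    case True
    then show ?thesis using nest_le_iff[of b c] block_finite_nonempty[of _ \<pi>] assms unfolding straddled_def by blast
  next
    case False
    then have dis: "b \<inter> c = {}" using disjoint_blocks assms by blast
    obtain x y z where xyz: "y \<in> c" "x \<in> b" "z \<in> b" "x \<le> y" "y \<le> z"
      using s unfolding straddled_def by blast
    have xyz': "x < y" "y < z"
      using xyz dis by (auto simp: order.order_iff_strict)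
    have nc: "\<not> (p < q \<and> q < r \<and> r < t)"
      if "d \<in> {b, c}" "d' \<in> {b, c}" "d \<noteq> d'" "p \<in> d" "q \<in> d'" "r \<in> d" "t \<in> d'" for d d' p q r t
    proof -
      have "d \<in> blocks \<pi>" "d' \<in> blocks \<pi>" using that assms by auto
      then show ?thesis
        using noncrossingD[OF noncrossing_blocks] that(3-) by blast
    qed
    have "straddled {t} b" if t: "t \<in> c" for t
    proof -
      have "t \<noteq> x" "t \<noteq> z" using t xyz dis by auto
      then have "x \<le> t" "t \<le> z"
        using nc[of c b t x y z] nc[of b c x y z t] False t xyz xyz' by (auto simp: not_le not_less order.order_iff_strict)
      then show ?thesis using xyz unfolding straddled_def by blast
    qed
    then show ?thesis
      using nest_le_iff[of b c] block_finite_nonempty[of _ \<pi>] assms by blast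
  qed
qed

lemma ideals_iff:
  "J \<in> ideals \<pi> \<longleftrightarrow> J \<subseteq> blocks \<pi> \<and> (\<forall>b\<in>J. \<forall>c\<in>blocks \<pi>. straddled c b \<longrightarrow> c \<in> J)"
  (is "?L \<longleftrightarrow> ?R")
proof -
  have "nest_le b c \<longleftrightarrow> straddled c b" if "J \<subseteq> blocks \<pi>" "b \<in> J" "c \<in> blocks \<pi>" for b c
    by (rule nest_le_iff_straddled[of _ \<pi>]) (use that in auto)
  then show ?thesis
    by (simp only: ideals_def mem_Collect_eq cong: conj_cong ball_cong)
qed

lemma separated_ideals_subset: "separated_ideals (blocks \<pi>) \<subseteq> ideals \<pi>"
proof
  fix J assume J: "J \<in> separated_ideals (blocks \<pi>)"
  have "J \<subseteq> blocks \<pi>"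
    using J by (simp add: separated_ideals_def)
  moreover have "\<forall>c\<in>blocks \<pi>. straddled c b \<longrightarrow> c \<in> J" if "b \<in> J" for b
  proof -
    have "(\<forall>c\<in>blocks \<pi>. straddled c (b \<union> b) \<longrightarrow> c \<in> J) \<longleftrightarrow> b = b"
      using J that unfolding separated_ideals_def by blast
    then show ?thesis by simp
  qed
  ultimately show "J \<in> ideals \<pi>"
    by (simp add: ideals_iff)
qed

text \<open>
  Validity mentions blocks only through straddling, so a bijection preserving straddling
  transports colourings.
\<close>
lemma card_valid_colourings_transport:
  assumes bij: "bij_betw e Y Y'"
    and e: "\<And>b b' c. b \<in> Y \<Longrightarrow> b' \<in> Y \<Longrightarrow> c \<in> Y \<Longrightarrow>
              straddled (e c) (e b \<union> e b') \<longleftrightarrow> straddled c (b \<union> b')"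
  shows "card (valid_colourings Y' n) = card (valid_colourings Y n)"
proof -
  let ?d = "inv_into Y e"
  have d: "?d (e b) = b" "e b \<in> Y'" if "b \<in> Y" for b
    using bij that by (auto simp: bij_betw_def)
  have d': "e (?d b) = b" "?d b \<in> Y" if "b \<in> Y'" for b
    using bij that by (auto simp: bij_betw_def f_inv_into_f inv_into_into)
  have Y': "Y' = e ` Y" and inj: "inj_on e Y"
    using bij by (auto simp: bij_betw_def)
  have link: "linked Y' g (e b) (e b') \<longleftrightarrow> linked Y f b b'"
    if "\<And>c. c \<in> Y \<Longrightarrow> g (e c) = f c" "b \<in> Y" "b' \<in> Y" for f g b b'
    using that e[of b b'] unfolding linked_def Y' by simp
  have "bij_betw (\<lambda>g. restrict (\<lambda>b. g (e b)) Y) (valid_colourings Y' n) (valid_colourings Y n)"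
  proof (rule bij_betw_byWitness[where f' = "\<lambda>f. restrict (\<lambda>b. f (?d b)) Y'"])
    show "\<forall>g\<in>valid_colourings Y' n. (\<lambda>b\<in>Y'. (\<lambda>b\<in>Y. g (e b)) (?d b)) = g"
      using d' by (auto simp: fun_eq_iff valid_colourings_def PiE_def extensional_def)
    show "\<forall>f\<in>valid_colourings Y n. (\<lambda>b\<in>Y. (\<lambda>b\<in>Y'. f (?d b)) (e b)) = f"
      using d by (auto simp: fun_eq_iff valid_colourings_def PiE_def extensional_def)
    show "(\<lambda>g. \<lambda>b\<in>Y. g (e b)) ` valid_colourings Y' n \<subseteq> valid_colourings Y n"
    proof (rule image_subsetI)
      fix g assume g: "g \<in> valid_colourings Y' n"
      have "linked Y (\<lambda>b\<in>Y. g (e b)) b b' \<longleftrightarrow> b = b'" if "b \<in> Y" "b' \<in> Y" for b b'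
        using link[of g "\<lambda>b\<in>Y. g (e b)" b b'] that g inj d unfolding valid_colourings_def
        by (auto simp: inj_on_eq_iff)
      then show "(\<lambda>b\<in>Y. g (e b)) \<in> valid_colourings Y n"
        using g d by (auto simp: valid_colourings_def)
    qed
    show "(\<lambda>f. \<lambda>b\<in>Y'. f (?d b)) ` valid_colourings Y n \<subseteq> valid_colourings Y' n"
    proof (rule image_subsetI)
      fix f assume f: "f \<in> valid_colourings Y n"
      have "linked Y' (\<lambda>b\<in>Y'. f (?d b)) b b' \<longleftrightarrow> b = b'" if "b \<in> Y'" "b' \<in> Y'" for b b'
      proof -
        have "linked Y' (\<lambda>b\<in>Y'. f (?d b)) b b' \<longleftrightarrow> linked Y f (?d b) (?d b')"
          using link[of "\<lambda>b\<in>Y'. f (?d b)" f "?d b" "?d b'"] that d d' by simp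
        also have "\<dots> \<longleftrightarrow> ?d b = ?d b'"
          using f d' that by (simp add: valid_colourings_def)
        also have "\<dots> \<longleftrightarrow> b = b'"
          using d'(1) that by metis
        finally show ?thesis .
      qed
      then show "(\<lambda>b\<in>Y'. f (?d b)) \<in> valid_colourings Y' n"
        using f d' by (auto simp: valid_colourings_def)
    qed
  qed
  then show ?thesis
    by (rule bij_betw_same_card)
qed

definition rank :: "nat set \<Rightarrow> nat \<Rightarrow> nat" where
  "rank U x = card {y \<in> U. y \<le> x}"

lemma renumber_conv: "renumber Y = (`) (rank (\<Union>Y)) ` Y"
  by (simp add: renumber_def rank_def)

lemma rank_less:
  assumes "finite U" "x < x'" "x' \<in> U"
  shows "rank U x < rank U x'"
proof -
  have "{y \<in> U. y \<le> x} \<subseteq> {y \<in> U. y \<le> x'}" "x' \<in> {y \<in> U. y \<le> x'} - {y \<in> U. y \<le> x}"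
    using assms by auto
  then have "{y \<in> U. y \<le> x} \<subset> {y \<in> U. y \<le> x'}"
    by blast
  then show ?thesis
    unfolding rank_def using assms(1) by (intro psubset_card_mono) auto
qed

lemma rank_le_iff:
  assumes "finite U" "x \<in> U" "x' \<in> U"
  shows "rank U x \<le> rank U x' \<longleftrightarrow> x \<le> x'"
  using rank_less[OF assms(1), of x x'] rank_less[OF assms(1), of x' x] assms(2,3)
  by (cases x x' rule: linorder_cases) auto

lemma bij_betw_rank:
  assumes "finite U"
  shows "bij_betw (rank U) U {1..card U}"
proof -
  have inj: "inj_on (rank U) U"
    using rank_le_iff[OF assms] by (intro inj_onI) (metis order_antisym order_refl)
  have "rank U ` U \<subseteq> {1..card U}"
    unfolding rank_def using assms
    by (auto intro!: card_mono simp: Suc_le_eq card_gt_0_iff)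
  then have "rank U ` U = {1..card U}"
    using inj by (intro card_subset_eq) (auto simp: card_image)
  with inj show ?thesis by (simp add: bij_betw_def)
qed

lemma straddled_rank:
  assumes "finite U" "c \<subseteq> U" "A \<subseteq> U"
  shows "straddled (rank U ` c) (rank U ` A) \<longleftrightarrow> straddled c A"
proof -
  have "rank U x \<le> rank U y \<longleftrightarrow> x \<le> y" if "x \<in> c \<union> A" "y \<in> c \<union> A" for x y
    using assms that by (intro rank_le_iff) auto
  then show ?thesis
    unfolding straddled_def by auto
qed

lemma bij_betw_renumber:
  assumes "finite (\<Union>Y)"
  shows "bij_betw ((`) (rank (\<Union>Y))) Y (renumber Y)"
proof -
  have "inj_on ((`) (rank (\<Union>Y))) Y"
    by (rule inj_on_subset[OF inj_on_image_Pow[OF bij_betw_imp_inj_on[OF bij_betw_rank[OF assms]]]]) auto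
  then show ?thesis
    by (simp add: bij_betw_def renumber_conv)
qed

lemma card_valid_colourings_renumber:
  assumes "finite (\<Union>Y)"
  shows "card (valid_colourings (renumber Y) n) = card (valid_colourings Y n)"
proof (rule card_valid_colourings_transport[OF bij_betw_renumber[OF assms]])
  fix b b' c assume "b \<in> Y" "b' \<in> Y" "c \<in> Y"
  then show "straddled (rank (\<Union>Y) ` c) (rank (\<Union>Y) ` b \<union> rank (\<Union>Y) ` b') \<longleftrightarrow> straddled c (b \<union> b')"
    unfolding image_Un[symmetric] by (intro straddled_rank assms) auto
qed

lemma finite_Union_blocks: "Y \<subseteq> blocks \<pi> \<Longrightarrow> finite (\<Union>Y)"
  using finite_blocks[of \<pi>] block_finite_nonempty(1)[of _ \<pi>] by (auto intro!: finite_Union intro: finite_subset)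

lemma blocks_Abs_renumber:
  assumes Y: "Y \<subseteq> blocks \<pi>" "Y \<noteq> {}"
  shows "blocks (Abs_ncp (renumber Y)) = renumber Y"
proof -
  let ?U = "\<Union>Y"
  have fin: "finite ?U" using Y finite_Union_blocks by blast
  have ne: "?U \<noteq> {}" using Y block_finite_nonempty by blast
  have bij: "bij_betw (rank ?U) ?U {1..card ?U}"
    by (rule bij_betw_rank[OF fin])
  have part: "partition_on {1..card ?U} (renumber Y)"
  proof (rule partition_onI)
    show "\<Union> (renumber Y) = {1..card ?U}"
      using bij by (simp add: renumber_conv bij_betw_def image_Union[symmetric])
    show "disjnt p q" if pq: "p \<in> renumber Y" "q \<in> renumber Y" "p \<noteq> q" for p q
    proof -
      obtain b b' where b: "b \<in> Y" "b' \<in> Y" "p = rank ?U ` b" "q = rank ?U ` b'"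
        using pq by (auto simp: renumber_conv)
      then have "b \<inter> b' = {}"
        using pq disjoint_blocks Y by blast
      then have "p \<inter> q = {}"
        using inj_on_image_Int[OF bij_betw_imp_inj_on[OF bij], of b b'] b by auto
      then show ?thesis by (simp add: disjnt_def)
    qed
    show "{} \<notin> renumber Y"
      using Y block_finite_nonempty(2)[of _ \<pi>] by (auto simp: renumber_conv)
  qed
  have less: "rank ?U x < rank ?U y \<longleftrightarrow> x < y" if "x \<in> ?U" "y \<in> ?U" for x y
    using rank_le_iff[OF fin, of y x] that by (simp add: linorder_not_le[symmetric])
  have "noncrossing (renumber Y)"
    unfolding noncrossing_def
  proof (rule notI, elim bexE conjE)
    fix p q x z y t assume "p \<in> renumber Y" "q \<in> renumber Y" and ne: "p \<noteq> q"
      and mem: "x \<in> p" "z \<in> p" "y \<in> q" "t \<in> q" and lt: "x < y" "y < z" "z < t"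
    then obtain b b' where b: "b \<in> Y" "b' \<in> Y" "p = rank ?U ` b" "q = rank ?U ` b'"
      by (auto simp: renumber_conv)
    obtain x' z' y' t' where r: "x = rank ?U x'" "z = rank ?U z'" "y = rank ?U y'" "t = rank ?U t'"
      "x' \<in> b" "z' \<in> b" "y' \<in> b'" "t' \<in> b'"
      using mem b by blast
    then have "x' \<in> ?U" "z' \<in> ?U" "y' \<in> ?U" "t' \<in> ?U" using b by auto
    then have "x' < y'" "y' < z'" "z' < t'" using lt r less by auto
    moreover have "b \<noteq> b'" "b \<in> blocks \<pi>" "b' \<in> blocks \<pi>" using ne b Y by auto
    ultimately show False
      using noncrossingD[OF noncrossing_blocks] r by blast
  qed
  moreover have "card ?U \<ge> 1"
    using fin ne by (simp add: Suc_le_eq card_gt_0_iff)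
  ultimately show ?thesis
    using part by (intro Abs_ncp_inverse) blast
qed

lemma interval_in_run:
  assumes U: "finite U" and I: "{a..c} \<subseteq> U" "a \<le> c"
  obtains R where "R \<in> runs U" "{a..c} \<subseteq> R"
proof -
  let ?A = "{I. I \<subseteq> U \<and> (\<exists>a c. I = {a..c})}"
  have "finite ?A" using U by auto
  moreover have "{a..c} \<in> ?A" using I by blast
  ultimately obtain R where R: "R \<in> ?A" "{a..c} \<subseteq> R" "\<And>I. I \<in> ?A \<Longrightarrow> R \<subseteq> I \<Longrightarrow> R = I"
    using finite_has_maximal2[of ?A "{a..c}"] by auto
  have "R \<in> runs U"
    unfolding runs_def using R I by auto
  then show thesis using that R by blast
qed

lemma run_absorbs:
  assumes "R \<in> runs U" "{a..c} \<subseteq> U" "{a..c} \<inter> R \<noteq> {}"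
  shows "{a..c} \<subseteq> R"
proof -
  obtain p q where R: "R = {p..q}" "R \<subseteq> U"
    and mx: "\<And>a c. R \<subseteq> {a..c} \<Longrightarrow> {a..c} \<subseteq> U \<Longrightarrow> {a..c} = R"
    using assms(1) unfolding runs_def by blast
  have "{min a p..max c q} \<subseteq> {a..c} \<union> R"
    using assms(3) unfolding R(1) by auto
  then have "{min a p..max c q} = R"
    using assms(2) R by (intro mx) auto
  then show ?thesis by auto
qed

text \<open>
  Since the elements of a partition are consecutive, the hull of a block of an ideal stays inside
  the ideal, and so every run is a union of blocks. Two blocks of the ideal lie in the same run
  precisely when the hull of their union stays inside the ideal; being separated forbids this for
  distinct blocks.
\<close>
lemma separated_ideals_iff_runs:
  assumes J: "J \<in> ideals \<pi>"
  shows "J \<in> separated_ideals (blocks \<pi>) \<longleftrightarrow> (\<forall>I\<in>runs (\<Union>J). card {b \<in> blocks \<pi>. b \<subseteq> I} = 1)"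
    and "I \<in> runs (\<Union>J) \<Longrightarrow> {b \<in> blocks \<pi>. b \<subseteq> I} \<noteq> {}"
proof -
  have JY: "J \<subseteq> blocks \<pi>" and up: "\<And>b c. b \<in> J \<Longrightarrow> c \<in> blocks \<pi> \<Longrightarrow> straddled c b \<Longrightarrow> c \<in> J"
    using J by (auto simp: ideals_iff)
  have fin: "finite (\<Union>J)" using JY finite_Union_blocks by blast
  have hull: "{x..z} \<subseteq> \<Union>J" if bb': "b \<in> J" "b' \<in> J" "\<And>c. c \<in> blocks \<pi> \<Longrightarrow> straddled c (b \<union> b') \<Longrightarrow> c \<in> J"
    and xz: "x \<in> b \<union> b'" "z \<in> b \<union> b'" for b b' x z
  proof
    fix y assume y: "y \<in> {x..z}"
    then have "y \<in> \<Union> (blocks \<pi>)"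
      using in_block_between[of x \<pi> z y] bb'(1,2) xz JY by auto
    then obtain c where c: "c \<in> blocks \<pi>" "y \<in> c" by blast
    then have "straddled c (b \<union> b')" using y xz unfolding straddled_def by auto
    then show "y \<in> \<Union>J" using bb'(3) c by blast
  qed
  have block_in_run: "b \<subseteq> I" if I: "I \<in> runs (\<Union>J)" and b: "b \<in> J" "b \<inter> I \<noteq> {}" for I b
  proof
    fix z assume z: "z \<in> b"
    obtain x where x: "x \<in> b" "x \<in> I" using b by blast
    have "{min x z..max x z} \<subseteq> \<Union>J"
      by (rule hull[of b b]) (use b up x z in \<open>auto simp: min_def max_def\<close>)
    then have "{min x z..max x z} \<subseteq> I"
      by (rule run_absorbs[OF I]) (use x in \<open>auto intro!: exI[of _ x] simp: disjoint_iff\<close>)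
    then show "z \<in> I" by auto
  qed
  show ne: "{b \<in> blocks \<pi>. b \<subseteq> I} \<noteq> {}" if I: "I \<in> runs (\<Union>J)" for I
  proof -
    obtain x where "x \<in> I" "x \<in> \<Union>J" using I unfolding runs_def by blast
    then obtain b where "b \<in> J" "x \<in> b" by blast
    then have "b \<subseteq> I" using block_in_run[OF I] \<open>x \<in> I\<close> by blast
    then show ?thesis using \<open>b \<in> J\<close> JY by blast
  qed
  have in_J: "c \<in> J" if "c \<in> blocks \<pi>" "x \<in> c" "x \<in> \<Union>J" for c x
    using that disjoint_blocks JY by blast
  show "J \<in> separated_ideals (blocks \<pi>) \<longleftrightarrow> (\<forall>I\<in>runs (\<Union>J). card {b \<in> blocks \<pi>. b \<subseteq> I} = 1)"
  proof
    assume "J \<in> separated_ideals (blocks \<pi>)"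
    then have sep: "b = b'" if "b \<in> J" "b' \<in> J" "\<And>c. c \<in> blocks \<pi> \<Longrightarrow> straddled c (b \<union> b') \<Longrightarrow> c \<in> J" for b b'
      using that unfolding separated_ideals_def by blast
    show "\<forall>I\<in>runs (\<Union>J). card {b \<in> blocks \<pi>. b \<subseteq> I} = 1"
    proof
      fix I assume I: "I \<in> runs (\<Union>J)"
      then obtain p q where pq: "I = {p..q}" "I \<subseteq> \<Union>J" unfolding runs_def by blast
      obtain b where b: "b \<in> blocks \<pi>" "b \<subseteq> I" using ne[OF I] by blast
      have "b' = b" if b': "b' \<in> blocks \<pi>" "b' \<subseteq> I" for b'
      proof (rule sep)
        show "b' \<in> J" "b \<in> J"
          using b b' in_J pq block_finite_nonempty by (metis all_not_in_conv subsetD)+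
        show "c \<in> J" if c: "c \<in> blocks \<pi>" "straddled c (b' \<union> b)" for c
        proof -
          obtain y x z where y: "y \<in> c" "x \<in> b' \<union> b" "z \<in> b' \<union> b" "x \<le> y" "y \<le> z"
            using c(2) unfolding straddled_def by blast
          then have "x \<in> I" "z \<in> I" using b b' by auto
          then have "y \<in> I" using y unfolding pq(1) by auto
          then show ?thesis using in_J[OF c(1) y(1)] pq(2) by blast
        qed
      qed
      then have "{b \<in> blocks \<pi>. b \<subseteq> I} = {b}" using b by blast
      then show "card {b \<in> blocks \<pi>. b \<subseteq> I} = 1" by simp
    qed
  next
    assume one: "\<forall>I\<in>runs (\<Union>J). card {b \<in> blocks \<pi>. b \<subseteq> I} = 1"
    have "b = b'" if bb': "b \<in> J" "b' \<in> J" "\<And>c. c \<in> blocks \<pi> \<Longrightarrow> straddled c (b \<union> b') \<Longrightarrow> c \<in> J" for b b'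
    proof -
      have "b \<noteq> {}" "b' \<noteq> {}"
        using bb'(1,2) JY block_finite_nonempty(2)[of _ \<pi>] by auto
      then obtain x z where xz: "x \<in> b" "z \<in> b'"
        by blast
      have sub: "{min x z..max x z} \<subseteq> \<Union>J"
        by (rule hull[of b b']) (use bb' xz in \<open>auto simp: min_def max_def\<close>)
      obtain I where I: "I \<in> runs (\<Union>J)" "{min x z..max x z} \<subseteq> I"
        by (rule interval_in_run[OF fin sub]) auto
      then have "x \<in> I" "z \<in> I" by auto
      then have "b \<subseteq> I" "b' \<subseteq> I"
        using block_in_run[OF I(1) bb'(1)] block_in_run[OF I(1) bb'(2)] xz by auto
      then show ?thesis
      proof -
        obtain d where d: "{b \<in> blocks \<pi>. b \<subseteq> I} = {d}"
          using one I(1) card_1_singletonE by blast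
        have "b \<in> {b \<in> blocks \<pi>. b \<subseteq> I}" "b' \<in> {b \<in> blocks \<pi>. b \<subseteq> I}"
          using \<open>b \<subseteq> I\<close> \<open>b' \<subseteq> I\<close> bb'(1,2) JY by auto
        then show ?thesis
          unfolding d by simp
      qed
    qed
    moreover have "\<forall>c\<in>blocks \<pi>. straddled c (b \<union> b) \<longrightarrow> c \<in> J" if "b \<in> J" for b
      using up that by simp
    ultimately have "(\<forall>c\<in>blocks \<pi>. straddled c (b \<union> b') \<longrightarrow> c \<in> J) \<longleftrightarrow> b = b'"
      if "b \<in> J" "b' \<in> J" for b b'
      using that by blast
    then show "J \<in> separated_ideals (blocks \<pi>)"
      using JY by (simp add: separated_ideals_def)
  qed
qed

section \<open>The morphism counts valid colourings\<close>

lemma prod_mset_image_sum: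
  "(\<Prod>\<rho>\<in>#(\<Sum>i\<in>A. M i). g \<rho>) = (\<Prod>i\<in>A. \<Prod>\<rho>\<in>#M i. (g \<rho> :: 'a::comm_monoid_mult))"
  by (induction A rule: infinite_finite_induct) auto

lemma prod_indicator:
  "finite A \<Longrightarrow> (\<Prod>i\<in>A. if P i then 1 else 0 :: 'a::comm_semiring_1) = (if \<forall>i\<in>A. P i then 1 else 0)"
  by (induction A rule: finite_induct) auto

lemma finite_runs: "finite U \<Longrightarrow> finite (runs U)"
  by (rule finite_subset[of _ "Pow U"]) (auto simp: runs_def)

text \<open>
  The counit is multiplicative, and its value at the restriction to a run tells whether the run
  consists of one block.
\<close>
lemma counit_delta_dot_restr:
  assumes J: "J \<in> ideals \<pi>"
  shows "counit_delta (mon (dot_restr \<pi> J)) =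
    (if J \<in> separated_ideals (blocks \<pi>) then 1 else 0 :: 'k::field_char_0)"
proof -
  have fin: "finite (runs (\<Union>J))"
    using J by (intro finite_runs finite_Union_blocks[of _ \<pi>]) (simp add: ideals_iff)
  have factor: "(\<Prod>\<rho>\<in>#restr {b \<in> blocks \<pi>. b \<subseteq> I}. if card (blocks \<rho>) = 1 then 1 else 0 :: 'k) =
      (if card {b \<in> blocks \<pi>. b \<subseteq> I} = 1 then 1 else 0)" if I: "I \<in> runs (\<Union>J)" for I
  proof -
    let ?Y = "{b \<in> blocks \<pi>. b \<subseteq> I}"
    have ne: "?Y \<noteq> {}" by (rule separated_ideals_iff_runs(2)[OF J I])
    have sub: "?Y \<subseteq> blocks \<pi>" by blast
    have "card (renumber ?Y) = card ?Y"
      using bij_betw_same_card[OF bij_betw_renumber[OF finite_Union_blocks[OF sub]]] by simp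
    then show ?thesis
      using ne blocks_Abs_renumber[OF sub ne] by (simp add: restr_def del: Collect_empty_eq)
  qed
  show ?thesis
    unfolding counit_delta_def character_mon dot_restr_def prod_mset_image_sum
    by (simp only: factor prod_indicator[OF fin] separated_ideals_iff_runs(1)[OF J] cong: prod.cong)
qed

text \<open>
  Evaluating compatibility with the first coproduct at \<open>(n, 1)\<close> gives a recursion for the values
  of \<open>\<phi>\<close>: on the second factor, evaluation at \<open>1\<close> is the counit of \<open>\<delta>\<close> and selects
  the separated ideals. Valid colourings satisfy the same recursion, and the counit of the first
  coproduct gives the same start at \<open>0\<close>. Splitting off \<open>1\<close> on the second factor rather
  than the first leaves a single partition to which induction applies, instead of a product.
\<close>
lemma poly_morphism_counts_valid_colourings:
  fixes \<phi> :: "'k::field_char_0 ncp_alg \<Rightarrow> 'k poly"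
  assumes "double_bialgebra_morphism \<phi>"
  shows "poly (\<phi> (mon {#\<pi>#})) (of_nat n) = of_nat (card (valid_colourings (blocks \<pi>) n))"
proof (induction n arbitrary: \<pi>)
  case 0
  have "poly (\<phi> (mon {#\<pi>#})) 0 = counit_Delta (mon {#\<pi>#})"
    using assms by (simp add: double_bialgebra_morphism_def)
  then show ?case
    by (simp add: counit_Delta_def character_mon valid_colourings_zero blocks_nonempty)
next
  case (Suc n)
  have alg: "alg_morphism \<phi>" using assms by (simp add: double_bialgebra_morphism_def)
  have low: "poly (\<phi> (mon (restr (blocks \<pi> - J)))) (of_nat n) =
      of_nat (card (valid_colourings (blocks \<pi> - J) n))" for J
  proof (cases "blocks \<pi> - J = {}")
    case True
    then have "restr (blocks \<pi> - J) = {#}"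
      by (simp add: restr_def)
    then show ?thesis
      by (simp only: True alg_morphism_mon(1)[OF alg] valid_colourings_empty) simp
  next
    case False
    have sub: "blocks \<pi> - J \<subseteq> blocks \<pi>" by blast
    show ?thesis
      using False by (simp only: restr_def if_False Suc blocks_Abs_renumber[OF sub False]
        card_valid_colourings_renumber[OF finite_Union_blocks[OF sub]])
  qed
  have top: "poly (\<phi> (mon (dot_restr \<pi> J))) 1 =
      (if J \<in> separated_ideals (blocks \<pi>) then 1 else 0)" if "J \<in> ideals \<pi>" for J
    using assms counit_delta_dot_restr[OF that, where 'k = 'k]
    by (simp add: double_bialgebra_morphism_def)
  have fin: "finite (ideals \<pi>)"
    by (rule finite_subset[of _ "Pow (blocks \<pi>)"]) (auto simp: ideals_def finite_blocks)
  have "poly (\<phi> (mon {#\<pi>#})) (of_nat n + 1) =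
    (\<Sum>J\<in>ideals \<pi>. poly (\<phi> (mon (restr (blocks \<pi> - J)))) (of_nat n) * poly (\<phi> (mon (dot_restr \<pi> J))) 1)"
    by (rule poly_eval_sum_Delta) (use assms in \<open>simp add: double_bialgebra_morphism_def\<close>)
  also have "\<dots> = (\<Sum>J\<in>ideals \<pi>. if J \<in> separated_ideals (blocks \<pi>)
      then of_nat (card (valid_colourings (blocks \<pi> - J) n)) else 0)"
    by (intro sum.cong refl) (simp add: low top)
  also have "\<dots> = (\<Sum>J\<in>ideals \<pi> \<inter> separated_ideals (blocks \<pi>).
      of_nat (card (valid_colourings (blocks \<pi> - J) n)))"
    by (simp add: sum.inter_restrict[OF fin])
  also have "ideals \<pi> \<inter> separated_ideals (blocks \<pi>) = separated_ideals (blocks \<pi>)"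
    using separated_ideals_subset by blast
  finally show ?case
    by (simp add: card_valid_colourings_Suc[OF finite_blocks] add.commute)
qed

section \<open>Contractions and link relations\<close>

definition link_rel :: "nat set set \<Rightarrow> (nat set \<Rightarrow> nat) \<Rightarrow> (nat set \<times> nat set) set" where
  "link_rel Y f = {(b, b'). b \<in> Y \<and> b' \<in> Y \<and> linked Y f b b'}"

definition class_union :: "(nat set \<times> nat set) set \<Rightarrow> nat set \<Rightarrow> nat set" where
  "class_union E b = \<Union> (E `` {b})"

lemma quot_blocks_conv: "quot_blocks \<pi> E = class_union E ` blocks \<pi>"
  by (auto simp: quot_blocks_def class_union_def quotient_def)

lemma straddled_class_union: "straddled (class_union E b) A \<longleftrightarrow> (\<exists>c. (b, c) \<in> E \<and> straddled c A)"
  unfolding straddled_def class_union_def by auto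

context
  fixes \<pi> :: ncp and E :: "(nat set \<times> nat set) set"
  assumes equiv: "equiv (blocks \<pi>) E"
begin

lemma classes:
  shows "(b, b') \<in> E \<Longrightarrow> b \<in> blocks \<pi> \<and> b' \<in> blocks \<pi>"
    and "b \<in> blocks \<pi> \<Longrightarrow> (b, b) \<in> E"
    and "(b, b') \<in> E \<Longrightarrow> (b', b) \<in> E"
    and "(b, b') \<in> E \<Longrightarrow> (b', b'') \<in> E \<Longrightarrow> (b, b'') \<in> E"
  using equiv by (auto simp: equiv_def refl_on_def dest: symD transD)

lemma block_subset_class_union: "(b, c) \<in> E \<Longrightarrow> c \<subseteq> class_union E b"
  by (auto simp: class_union_def)

lemma class_union_meet:
  assumes "x \<in> class_union E b" "x \<in> class_union E b'"
  shows "(b, b') \<in> E"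
proof -
  obtain c c' where c: "(b, c) \<in> E" "(b', c') \<in> E" "x \<in> c" "x \<in> c'"
    using assms by (auto simp: class_union_def)
  then have "c = c'"
    using disjoint_blocks[of c \<pi> c'] classes(1) by blast
  then show ?thesis
    using c classes(3,4) by metis
qed

lemma class_union_eq_iff:
  assumes "b \<in> blocks \<pi>" "b' \<in> blocks \<pi>"
  shows "class_union E b = class_union E b' \<longleftrightarrow> (b, b') \<in> E"
proof
  assume eq: "class_union E b = class_union E b'"
  obtain x where "x \<in> b" using block_finite_nonempty(2) assms by blast
  then have "x \<in> class_union E b"
    using block_subset_class_union[OF classes(2)] assms by blast
  then show "(b, b') \<in> E"
    using class_union_meet[of x b b'] eq by simp
next
  assume "(b, b') \<in> E"
  then show "class_union E b = class_union E b'"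
    using equiv by (simp add: class_union_def equiv_class_eq_iff)
qed

lemma partition_on_quot_blocks:
  assumes "partition_on {1..n} (blocks \<pi>)"
  shows "partition_on {1..n} (quot_blocks \<pi> E)"
proof (rule partition_onI)
  have "\<Union> (quot_blocks \<pi> E) = \<Union> (blocks \<pi>)"
    unfolding quot_blocks_conv class_union_def using classes(1,2) by blast
  then show "\<Union> (quot_blocks \<pi> E) = {1..n}"
    using partition_onD1[OF assms] by simp
  show "disjnt p q" if "p \<in> quot_blocks \<pi> E" "q \<in> quot_blocks \<pi> E" "p \<noteq> q" for p q
    using that class_union_meet class_union_eq_iff unfolding quot_blocks_conv disjnt_iff by blast
  show "{} \<notin> quot_blocks \<pi> E"
  proof
    assume "{} \<in> quot_blocks \<pi> E"
    then obtain b where "b \<in> blocks \<pi>" "class_union E b = {}"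
      by (auto simp: quot_blocks_conv)
    then show False
      using block_subset_class_union[OF classes(2)] block_finite_nonempty(2) by blast
  qed
qed

lemma blocks_Abs_quot:
  assumes "noncrossing (quot_blocks \<pi> E)"
  shows "blocks (Abs_ncp (quot_blocks \<pi> E)) = quot_blocks \<pi> E"
proof -
  obtain n where "n \<ge> 1" "partition_on {1..n} (blocks \<pi>)"
    by (rule blocks_ncp)
  then show ?thesis
    using partition_on_quot_blocks assms by (intro Abs_ncp_inverse) blast
qed

text \<open>
  Both directions rest on how hulls of merged blocks decompose: the hull of one merged block is
  covered by the hulls of pairs of its constituents, and the hull of two merged blocks is covered
  by their own hulls together with the hull of one constituent of each. This is why contracting
  the linked blocks of a colouring leaves a valid colouring, and why pulling a valid colouring
  back creates no links beyond those in \<open>E\<close>.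
\<close>
lemma link_rel_eq_iff_valid_on_quotient:
  assumes F: "\<And>b. b \<in> blocks \<pi> \<Longrightarrow> F (class_union E b) = f b"
  shows "link_rel (blocks \<pi>) f = E \<longleftrightarrow>
    (\<forall>b\<in>blocks \<pi>. \<forall>b'\<in>blocks \<pi>.
       linked (quot_blocks \<pi> E) F (class_union E b) (class_union E b') \<longleftrightarrow>
       class_union E b = class_union E b')"
    (is "?L \<longleftrightarrow> ?R")
proof
  let ?q = "class_union E" and ?Y = "blocks \<pi>"
  have Q_iff: "linked (quot_blocks \<pi> E) F (?q b) (?q b') \<longleftrightarrow>
      f b = f b' \<and> (\<forall>c\<in>?Y. straddled (?q c) (?q b \<union> ?q b') \<longrightarrow> f b \<le> f c)"
    if "b \<in> ?Y" "b' \<in> ?Y" for b b'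
    using F that by (auto simp: linked_def quot_blocks_conv)
  have sub: "b \<subseteq> ?q b" if "b \<in> ?Y" for b
    using block_subset_class_union classes(2) that by blast
  have up: "straddled (?q c) (?q b \<union> ?q b')"
    if "c \<in> ?Y" "b \<in> ?Y" "b' \<in> ?Y" "straddled c (b \<union> b')" for b b' c
  proof -
    have "straddled c (?q b \<union> ?q b')"
      by (rule straddled_mono[OF that(4)]) (use sub that in blast)
    then show ?thesis
      using straddled_class_union classes(2) that(1) by blast
  qed
  {
    assume L: ?L
    have E_iff: "(b, b') \<in> E \<longleftrightarrow> b \<in> ?Y \<and> b' \<in> ?Y \<and> linked ?Y f b b'" for b b'
      using L[symmetric] by (simp add: link_rel_def)
    have f_eq: "f b = f b'" if "(b, b') \<in> E" for b b'
      using that E_iff by (simp add: linked_def)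
    have "linked (quot_blocks \<pi> E) F (?q b) (?q b') \<longleftrightarrow> ?q b = ?q b'"
      if b: "b \<in> ?Y" "b' \<in> ?Y" for b b'
    proof
      assume "linked (quot_blocks \<pi> E) F (?q b) (?q b')"
      then have *: "f b = f b'" "\<And>c. c \<in> ?Y \<Longrightarrow> straddled (?q c) (?q b \<union> ?q b') \<Longrightarrow> f b \<le> f c"
        using Q_iff[OF b] by auto
      have "linked ?Y f b b'"
        unfolding linked_def using * up[OF _ b] by blast
      then show "?q b = ?q b'"
        using E_iff class_union_eq_iff b by blast
    next
      assume eq: "?q b = ?q b'"
      then have "f b = f b'"
        using f_eq class_union_eq_iff b by blast
      moreover have "f b \<le> f c" if c: "c \<in> ?Y" "straddled (?q c) (?q b)" for c
      proof -
        obtain c' where c': "(c, c') \<in> E" "straddled c' (?q b)"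
          using c straddled_class_union by blast
        then obtain y x z b1 b2 where y: "y \<in> c'" "x \<in> b1" "z \<in> b2" "x \<le> y" "y \<le> z"
          "(b, b1) \<in> E" "(b, b2) \<in> E"
          unfolding straddled_def class_union_def by blast
        have "straddled c' (b1 \<union> b2)"
          using y unfolding straddled_def by blast
        moreover have "(b1, b2) \<in> E"
          using y classes(3,4) by metis
        ultimately have "f b1 \<le> f c'"
          using E_iff[of b1 b2] classes(1)[OF c'(1)] by (auto simp: linked_def)
        then show ?thesis
          using f_eq[OF c'(1)] f_eq[OF y(6)] by simp
      qed
      ultimately show "linked (quot_blocks \<pi> E) F (?q b) (?q b')"
        using Q_iff[OF b] eq by auto
    qed
    then show ?R by blast
  next
    assume R: ?R
    have self: "f b \<le> f c" if "b \<in> ?Y" "c \<in> ?Y" "straddled (?q c) (?q b)" for b c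
      using R Q_iff[of b b] that by auto
    have self': "f b \<le> f c" if "b \<in> ?Y" "c \<in> ?Y" "straddled c (?q b)" for b c
      by (rule self[OF that(1,2)]) (use straddled_class_union classes(2) that in blast)
    have "linked ?Y f b b' \<longleftrightarrow> (b, b') \<in> E" if b: "b \<in> ?Y" "b' \<in> ?Y" for b b'
    proof
      assume "(b, b') \<in> E"
      then have eq: "?q b = ?q b'" using class_union_eq_iff b by blast
      then have "f b = f b'" using F b by metis
      moreover have "f b \<le> f c" if "c \<in> ?Y" "straddled c (b \<union> b')" for c
        by (rule self'[OF b(1) that(1)], rule straddled_mono[OF that(2)]) (use sub b eq in blast)
      ultimately show "linked ?Y f b b'" by (simp add: linked_def)
    next
      assume link: "linked ?Y f b b'"
      have ff: "f b = f b'" using link by (simp add: linked_def)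
      have "f b \<le> f c" if c: "c \<in> ?Y" "straddled (?q c) (?q b \<union> ?q b')" for c
      proof -
        \<comment> \<open>Cut the hull of the two merged blocks at \<open>b\<close> and at \<open>b'\<close>.\<close>
        obtain c' where c': "(c, c') \<in> E" "straddled c' (?q b \<union> ?q b')"
          using c straddled_class_union by blast
        have cY: "c' \<in> ?Y" using classes(1)[OF c'(1)] by blast
        have ne: "b \<noteq> {}" "b' \<noteq> {}" using b block_finite_nonempty(2) by blast+
        have "straddled c' (?q b \<union> b) \<or> straddled c' (b \<union> b') \<or> straddled c' (b' \<union> ?q b')"
          using straddled_split[OF c'(2) ne(1)] straddled_split[OF _ ne(2), of c' b "?q b'"] by blast
        moreover have "?q b \<union> b = ?q b" "b' \<union> ?q b' = ?q b'"
          using sub b by auto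
        ultimately have "f b \<le> f c'"
          using self'[OF b(1) cY] self'[OF b(2) cY] link cY ff by (auto simp: linked_def)
        moreover have "f c = f c'"
          using F[of c] F[of c'] class_union_eq_iff[of c c'] c(1) cY c'(1) by simp
        ultimately show ?thesis by simp
      qed
      then have "linked (quot_blocks \<pi> E) F (?q b) (?q b')"
        using Q_iff[OF b] ff by blast
      then show "(b, b') \<in> E"
        using R b class_union_eq_iff by blast
    qed
    then show ?L
      using classes(1) unfolding link_rel_def by auto
  }
qed

lemma card_link_rel_fibre:
  "card {f \<in> blocks \<pi> \<rightarrow>\<^sub>E {1..n}. link_rel (blocks \<pi>) f = E} =
   card (valid_colourings (quot_blocks \<pi> E) n)"
proof -
  let ?Y = "blocks \<pi>" and ?Q = "quot_blocks \<pi> E" and ?q = "class_union E"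
  let ?r = "inv_into ?Y ?q"
  have r: "?r p \<in> ?Y" "?q (?r p) = p" if "p \<in> ?Q" for p
    using that by (auto simp: quot_blocks_conv inv_into_into f_inv_into_f)
  have q: "?q b \<in> ?Q" if "b \<in> ?Y" for b
    using that by (simp add: quot_blocks_conv)
  have valid: "(\<forall>p\<in>?Q. \<forall>p'\<in>?Q. linked ?Q F p p' \<longleftrightarrow> p = p') \<longleftrightarrow>
      (\<forall>b\<in>?Y. \<forall>b'\<in>?Y. linked ?Q F (?q b) (?q b') \<longleftrightarrow> ?q b = ?q b')" for F
    by (simp add: quot_blocks_conv)
  have "bij_betw (\<lambda>F. \<lambda>b\<in>?Y. F (?q b)) (valid_colourings ?Q n)
     {f \<in> ?Y \<rightarrow>\<^sub>E {1..n}. link_rel ?Y f = E}"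
  proof (rule bij_betw_byWitness[where f' = "\<lambda>f. \<lambda>p\<in>?Q. f (?r p)"])
    show "\<forall>F\<in>valid_colourings ?Q n. (\<lambda>p\<in>?Q. (\<lambda>b\<in>?Y. F (?q b)) (?r p)) = F"
      using r by (auto simp: fun_eq_iff valid_colourings_def PiE_def extensional_def)
    \<comment> \<open>Linked blocks share a colour, so the chosen representative of a class does not matter.\<close>
    have const: "(\<lambda>p\<in>?Q. f (?r p)) (?q b) = f b" if f: "link_rel ?Y f = E" and b: "b \<in> ?Y" for f b
    proof -
      have "(?r (?q b), b) \<in> E"
        using r[OF q[OF b]] b class_union_eq_iff by blast
      then show ?thesis
        using f q[OF b] by (auto simp: link_rel_def linked_def)
    qed
    show "\<forall>f\<in>{f \<in> ?Y \<rightarrow>\<^sub>E {1..n}. link_rel ?Y f = E}. (\<lambda>b\<in>?Y. (\<lambda>p\<in>?Q. f (?r p)) (?q b)) = f"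
      using const by (auto simp: fun_eq_iff PiE_def extensional_def)
    show "(\<lambda>F. \<lambda>b\<in>?Y. F (?q b)) ` valid_colourings ?Q n \<subseteq> {f \<in> ?Y \<rightarrow>\<^sub>E {1..n}. link_rel ?Y f = E}"
    proof (intro image_subsetI CollectI conjI)
      fix F assume F: "F \<in> valid_colourings ?Q n"
      then show "(\<lambda>b\<in>?Y. F (?q b)) \<in> ?Y \<rightarrow>\<^sub>E {1..n}"
        using q by (auto simp: valid_colourings_def)
      show "link_rel ?Y (\<lambda>b\<in>?Y. F (?q b)) = E"
        by (subst link_rel_eq_iff_valid_on_quotient[where F = F])
           (use F valid[of F] in \<open>simp_all add: valid_colourings_def\<close>)
    qed
    show "(\<lambda>f. \<lambda>p\<in>?Q. f (?r p)) ` {f \<in> ?Y \<rightarrow>\<^sub>E {1..n}. link_rel ?Y f = E} \<subseteq> valid_colourings ?Q n"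
    proof (rule image_subsetI)
      fix f assume "f \<in> {f \<in> ?Y \<rightarrow>\<^sub>E {1..n}. link_rel ?Y f = E}"
      then have f: "f \<in> ?Y \<rightarrow>\<^sub>E {1..n}" "link_rel ?Y f = E" by auto
      have "\<forall>p\<in>?Q. \<forall>p'\<in>?Q. linked ?Q (\<lambda>p\<in>?Q. f (?r p)) p p' \<longleftrightarrow> p = p'"
        unfolding valid
        by (rule iffD1[OF link_rel_eq_iff_valid_on_quotient f(2)]) (rule const[OF f(2)])
      moreover have "(\<lambda>p\<in>?Q. f (?r p)) \<in> ?Q \<rightarrow>\<^sub>E {1..n}"
        using f(1) r by auto
      ultimately show "(\<lambda>p\<in>?Q. f (?r p)) \<in> valid_colourings ?Q n"
        by (simp only: valid_colourings_def mem_Collect_eq)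
    qed
  qed
  then show ?thesis
    by (rule bij_betw_same_card[symmetric])
qed

end

text \<open>
  Overlapping hulls cover the hull of the union.
\<close>
lemma straddled_Un_overlap:
  assumes "straddled c (A \<union> B)" "y \<in> B" "straddled {y} A"
  shows "straddled c A \<or> straddled c B"
proof -
  obtain x0 z0 where y: "x0 \<in> A" "z0 \<in> A" "x0 \<le> y" "y \<le> z0"
    using assms(3) unfolding straddled_def by blast
  obtain u u1 u2 where u: "u \<in> c" "u1 \<in> A \<union> B" "u2 \<in> A \<union> B" "u1 \<le> u" "u \<le> u2"
    using assms(1) unfolding straddled_def by blast
  show ?thesis
  proof (cases "u \<le> y")
    case True
    then have "u \<le> z0" using y by simp
    then show ?thesis using u True assms(2) y unfolding straddled_def by blast
  next
    case False
    then have "y \<le> u" "x0 \<le> u" using y by simp_all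
    then show ?thesis using u assms(2) y unfolding straddled_def by blast
  qed
qed

text \<open>
  The link relation of a monotone colouring has a noncrossing quotient. If two classes crossed,
  each would contain a block meeting the hull of two blocks of the other one, so both would carry
  the same colour \<open>k\<close>; on the union of the two overlapping hulls all colours are at least \<open>k\<close>, and the classes
  would be linked to each other.
\<close>
lemma link_rel_in_Ec_iff:
  "link_rel (blocks \<pi>) f \<in> Ec \<pi> \<longleftrightarrow> (\<forall>b\<in>blocks \<pi>. linked (blocks \<pi>) f b b)"
proof
  assume "link_rel (blocks \<pi>) f \<in> Ec \<pi>"
  then have "refl_on (blocks \<pi>) (link_rel (blocks \<pi>) f)"
    by (simp add: Ec_def equiv_def)
  then show "\<forall>b\<in>blocks \<pi>. linked (blocks \<pi>) f b b"
    by (auto simp: refl_on_def link_rel_def)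
next
  let ?Y = "blocks \<pi>" and ?E = "link_rel (blocks \<pi>) f"
  assume ordered: "\<forall>b\<in>?Y. linked ?Y f b b"
  have equiv: "equiv ?Y ?E"
  proof (rule equivI)
    show "refl_on ?Y ?E"
      using ordered by (auto simp: refl_on_def link_rel_def)
    show "sym ?E"
      by (auto simp: sym_def link_rel_def intro: linked_sym)
    show "trans ?E"
      unfolding trans_def link_rel_def
      using linked_trans block_finite_nonempty(2) by blast
    show "?E \<subseteq> ?Y \<times> ?Y"
      by (auto simp: link_rel_def)
  qed
  have "False"
    if pq: "p \<in> quot_blocks \<pi> ?E" "q \<in> quot_blocks \<pi> ?E" "p \<noteq> q"
      and mem: "x \<in> p" "z \<in> p" "y \<in> q" "t \<in> q" and lt: "x < y" "y < z" "z < t" for p q x y z t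
  proof -
    obtain b0 c0 where p: "p = class_union ?E b0" "q = class_union ?E c0" "b0 \<in> ?Y" "c0 \<in> ?Y"
      using pq by (auto simp: quot_blocks_conv)
    obtain b1 b2 where b: "(b0, b1) \<in> ?E" "x \<in> b1" "(b0, b2) \<in> ?E" "z \<in> b2"
      using mem p by (auto simp: class_union_def)
    obtain c1 c2 where c: "(c0, c1) \<in> ?E" "y \<in> c1" "(c0, c2) \<in> ?E" "t \<in> c2"
      using mem p by (auto simp: class_union_def)
    have E: "(b1, b2) \<in> ?E" "(c1, c2) \<in> ?E"
      using b c classes(3,4)[OF equiv] by metis+
    then have Y: "b1 \<in> ?Y" "b2 \<in> ?Y" "c1 \<in> ?Y" "c2 \<in> ?Y"
      and linked: "linked ?Y f b1 b2" "linked ?Y f c1 c2"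
      by (auto simp: link_rel_def)
    have "straddled c1 (b1 \<union> b2)" "straddled b2 (c1 \<union> c2)"
      using b c lt unfolding straddled_def by (blast intro: less_imp_le)+
    then have eq: "f b1 = f c1"
      using linked Y by (fastforce simp: linked_def)
    have y: "y \<in> c1 \<union> c2" "straddled {y} (b1 \<union> b2)"
      using b c lt unfolding straddled_def by (auto intro!: less_imp_le)
    have "linked ?Y f b1 c1"
      unfolding linked_def
    proof (intro conjI ballI impI)
      fix d assume d: "d \<in> ?Y" "straddled d (b1 \<union> c1)"
      have "straddled d ((b1 \<union> b2) \<union> (c1 \<union> c2))"
        by (rule straddled_mono[OF d(2)]) blast
      from straddled_Un_overlap[OF this y] show "f b1 \<le> f d"
        using linked d(1) eq by (auto simp: linked_def)
    qed (rule eq)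
    then have "(b1, c1) \<in> ?E"
      using Y by (simp add: link_rel_def)
    then have "(b0, c0) \<in> ?E"
      using b c classes(3,4)[OF equiv] by metis
    then show False
      using pq(3) p class_union_eq_iff[OF equiv] by simp
  qed
  then have "noncrossing (quot_blocks \<pi> ?E)"
    unfolding noncrossing_def by meson
  then show "?E \<in> Ec \<pi>"
    using equiv by (simp add: Ec_def)
qed

lemma finite_Ec: "finite (Ec \<pi>)"
  by (rule finite_subset[of _ "Pow (blocks \<pi> \<times> blocks \<pi>)"])
     (auto simp: Ec_def finite_blocks dest: equiv_type)

text \<open>
  Sorting colourings by their link relation turns the count of monotone colourings into a sum
  over the contractions that define \<open>\<delta>\<close>.
\<close>
lemma card_link_rel_in:
  assumes "S \<subseteq> Ec \<pi>"
  shows "card {f \<in> blocks \<pi> \<rightarrow>\<^sub>E {1..n}. link_rel (blocks \<pi>) f \<in> S} =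
    (\<Sum>E\<in>S. card (valid_colourings (quot_blocks \<pi> E) n))"
proof -
  have fin: "finite (blocks \<pi> \<rightarrow>\<^sub>E {1..n})"
    by (intro finite_PiE finite_blocks) simp
  have "card {f \<in> blocks \<pi> \<rightarrow>\<^sub>E {1..n}. link_rel (blocks \<pi>) f \<in> S} =
      card (\<Union>E\<in>S. {f \<in> blocks \<pi> \<rightarrow>\<^sub>E {1..n}. link_rel (blocks \<pi>) f = E})"
    by (rule arg_cong[where f = card]) auto
  also have "\<dots> = (\<Sum>E\<in>S. card {f \<in> blocks \<pi> \<rightarrow>\<^sub>E {1..n}. link_rel (blocks \<pi>) f = E})"
    by (rule card_UN_disjoint) (use fin finite_subset[OF assms finite_Ec] in auto)
  also have "\<dots> = (\<Sum>E\<in>S. card (valid_colourings (quot_blocks \<pi> E) n))"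
    by (intro sum.cong refl card_link_rel_fibre) (use assms in \<open>auto simp: Ec_def\<close>)
  finally show ?thesis .
qed

lemma linked_self_iff:
  assumes "b \<in> blocks \<pi>"
  shows "linked (blocks \<pi>) f b b \<longleftrightarrow> (\<forall>c\<in>blocks \<pi>. nest_le b c \<longrightarrow> f b \<le> f c)"
  using nest_le_iff_straddled[OF assms] by (simp add: linked_def)

text \<open>
  The contractions all of whose classes consist of pairwise incomparable blocks, that is, those
  with \<open>\<lambda>\<^sup>s\<close> equal to \<open>1\<close> on the restriction to their classes.
\<close>
definition flat_relations :: "ncp \<Rightarrow> (nat set \<times> nat set) set set" where
  "flat_relations \<pi> = {E \<in> Ec \<pi>. \<forall>(b, c)\<in>E. nest_le b c \<longrightarrow> b = c}"

lemma weak_iff_link_rel: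
  "(\<forall>b\<in>blocks \<pi>. \<forall>c\<in>blocks \<pi>. nest_le b c \<longrightarrow> f b \<le> f c) \<longleftrightarrow> link_rel (blocks \<pi>) f \<in> Ec \<pi>"
  by (simp add: link_rel_in_Ec_iff linked_self_iff)

text \<open>
  Two nested blocks of the same colour are always linked when colours increase weakly, since all
  blocks in the outer hull have at least the colour of the outer block. So strictness fails
  exactly through a nested pair inside a class.
\<close>
lemma strict_iff_link_rel:
  "(\<forall>b\<in>blocks \<pi>. \<forall>c\<in>blocks \<pi>. nest_le b c \<and> b \<noteq> c \<longrightarrow> f b < f c) \<longleftrightarrow>
   link_rel (blocks \<pi>) f \<in> flat_relations \<pi>"
    (is "?L \<longleftrightarrow> ?R")
proof
  assume L: ?L
  have "f b \<le> f c" if "b \<in> blocks \<pi>" "c \<in> blocks \<pi>" "nest_le b c" for b c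
    using L that by (cases "b = c") (auto intro: less_imp_le)
  then have "link_rel (blocks \<pi>) f \<in> Ec \<pi>"
    using weak_iff_link_rel by blast
  moreover have "b = c" if "(b, c) \<in> link_rel (blocks \<pi>) f" "nest_le b c" for b c
    using L that by (fastforce simp: link_rel_def linked_def)
  ultimately show ?R by (auto simp: flat_relations_def)
next
  assume R: ?R
  have weak: "f b \<le> f c" if "b \<in> blocks \<pi>" "c \<in> blocks \<pi>" "nest_le b c" for b c
    using R that weak_iff_link_rel[of \<pi> f] by (simp add: flat_relations_def)
  show ?L
  proof (intro ballI impI, elim conjE)
    fix b c assume bc: "b \<in> blocks \<pi>" "c \<in> blocks \<pi>" "nest_le b c" "b \<noteq> c"
    have "f b \<noteq> f c"
    proof
      assume eq: "f b = f c"
      have sub: "straddled {y} b" if "y \<in> c" for y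
        using nest_le_iff[OF block_finite_nonempty[OF bc(1)]] bc(3) that by blast
      have "f b \<le> f d" if d: "d \<in> blocks \<pi>" "straddled d (b \<union> c)" for d
      proof -
        obtain y where "y \<in> c" using block_finite_nonempty(2)[OF bc(2)] by blast
        then have "straddled d b \<or> straddled d c"
          using straddled_Un_overlap[OF d(2)] sub by blast
        then show ?thesis
          using weak[of b d] weak[of c d] nest_le_iff_straddled[OF _ d(1)] bc d(1) eq by auto
      qed
      then have "(b, c) \<in> link_rel (blocks \<pi>) f"
        using bc eq by (simp add: link_rel_def linked_def)
      then show False
        using R bc by (auto simp: flat_relations_def)
    qed
    then show "f b < f c" using weak[OF bc(1-3)] by simp
  qed
qed

lemma Base_Abs_renumber_iff:
  assumes C: "C \<subseteq> blocks \<pi>" "C \<noteq> {}"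
  defines "\<rho> \<equiv> Abs_ncp (renumber C)"
  shows "blocks \<rho> = Base \<rho> \<longleftrightarrow> (\<forall>b\<in>C. \<forall>c\<in>C. nest_le b c \<longrightarrow> b = c)"
proof -
  let ?e = "(`) (rank (\<Union>C))"
  have fin: "finite (\<Union>C)" by (rule finite_Union_blocks[OF C(1)])
  have blocks: "blocks \<rho> = renumber C"
    unfolding \<rho>_def by (rule blocks_Abs_renumber[OF C])
  have nest: "nest_le (?e b) (?e c) \<longleftrightarrow> nest_le b c" if "b \<in> C" "c \<in> C" for b c
  proof -
    have "nest_le (?e b) (?e c) \<longleftrightarrow> straddled (?e c) (?e b)"
      by (rule nest_le_iff_straddled[of _ \<rho>]) (use that in \<open>auto simp: blocks renumber_conv\<close>)
    also have "\<dots> \<longleftrightarrow> straddled c b"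
      by (rule straddled_rank[OF fin]) (use that in auto)
    also have "\<dots> \<longleftrightarrow> nest_le b c"
      by (rule nest_le_iff_straddled[of _ \<pi>, symmetric]) (use that C in auto)
    finally show ?thesis .
  qed
  have inj: "?e b = ?e c \<longleftrightarrow> b = c" if "b \<in> C" "c \<in> C" for b c
    using bij_betw_renumber[OF fin] that by (auto simp: bij_betw_def inj_on_eq_iff)
  have "blocks \<rho> = Base \<rho> \<longleftrightarrow> (\<forall>b\<in>blocks \<rho>. \<forall>c\<in>blocks \<rho>. nest_le b c \<longrightarrow> b = c)"
    by (auto simp: Base_def)
  also have "\<dots> \<longleftrightarrow> (\<forall>b\<in>C. \<forall>c\<in>C. nest_le (?e b) (?e c) \<longrightarrow> ?e b = ?e c)"
    by (simp add: blocks renumber_conv)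
  also have "\<dots> \<longleftrightarrow> (\<forall>b\<in>C. \<forall>c\<in>C. nest_le b c \<longrightarrow> b = c)"
    using nest inj by simp
  finally show ?thesis .
qed

lemma lambda_s_dot_restr_equiv:
  assumes E: "E \<in> Ec \<pi>"
  shows "(\<Prod>\<rho>\<in>#dot_restr_equiv \<pi> E. if blocks \<rho> = Base \<rho> then 1 else 0 :: 'k::field_char_0) =
    (if E \<in> flat_relations \<pi> then 1 else 0)"
proof -
  have equiv: "equiv (blocks \<pi>) E" using E by (simp add: Ec_def)
  have fin: "finite (blocks \<pi> // E)"
    by (rule finite_quotient[OF finite_blocks equiv_type[OF equiv]])
  have factor: "(\<Prod>\<rho>\<in>#restr C. if blocks \<rho> = Base \<rho> then 1 else 0 :: 'k) =
      (if \<forall>b\<in>C. \<forall>c\<in>C. nest_le b c \<longrightarrow> b = c then 1 else 0)" if "C \<in> blocks \<pi> // E" for C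
  proof -
    have C: "C \<subseteq> blocks \<pi>" "C \<noteq> {}"
      using in_quotient_imp_subset[OF equiv that] in_quotient_imp_non_empty[OF equiv that] by auto
    show ?thesis
      using C(2) Base_Abs_renumber_iff[OF C] by (simp add: restr_def)
  qed
  have "(\<forall>C\<in>blocks \<pi> // E. \<forall>b\<in>C. \<forall>c\<in>C. nest_le b c \<longrightarrow> b = c) \<longleftrightarrow>
      (\<forall>(b, c)\<in>E. nest_le b c \<longrightarrow> b = c)" (is "?L \<longleftrightarrow> ?R")
  proof
    assume L: ?L
    have "b = c" if "(b, c) \<in> E" "nest_le b c" for b c
    proof -
      have "b \<in> blocks \<pi>" using classes(1)[OF equiv that(1)] by blast
      then have "E `` {b} \<in> blocks \<pi> // E" "b \<in> E `` {b}" "c \<in> E `` {b}"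
        using that classes(2)[OF equiv] by (auto intro: quotientI)
      then show ?thesis using L that(2) by blast
    qed
    then show ?R by blast
  next
    assume R: ?R
    have "(b, c) \<in> E" if "C \<in> blocks \<pi> // E" "b \<in> C" "c \<in> C" for C b c
      using in_quotient_imp_in_rel[OF equiv that(1)] that by simp
    then show ?L using R by blast
  qed
  then show ?thesis
    using E unfolding dot_restr_equiv_def prod_mset_image_sum
    by (simp add: factor prod_indicator[OF fin] flat_relations_def cong: prod.cong)
qed

section \<open>From partitions to monomials\<close>

text \<open>
  A colouring of a monomial is a family of independent colourings of its factors.
\<close>
lemma card_blockwise_maps:
  fixes n :: nat
  shows "card {f \<in> Bl P \<rightarrow>\<^sub>E {1..n}. \<forall>\<pi> i. i < count P \<pi> \<longrightarrow> (\<lambda>b\<in>blocks \<pi>. f (\<pi>, i, b)) \<in> W \<pi>} =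
   (\<Prod>\<pi>\<in>#P. card {g \<in> blocks \<pi> \<rightarrow>\<^sub>E {1..n}. g \<in> W \<pi>})"
proof -
  let ?I = "SIGMA \<pi>:set_mset P. {..<count P \<pi>}"
  let ?V = "\<lambda>\<pi>. {g \<in> blocks \<pi> \<rightarrow>\<^sub>E {1..n}. g \<in> W \<pi>}"
  let ?S = "{f \<in> Bl P \<rightarrow>\<^sub>E {1..n}. \<forall>\<pi> i. i < count P \<pi> \<longrightarrow> (\<lambda>b\<in>blocks \<pi>. f (\<pi>, i, b)) \<in> W \<pi>}"
  let ?to = "\<lambda>f. \<lambda>(\<pi>, i)\<in>?I. \<lambda>b\<in>blocks \<pi>. f (\<pi>, i, b)"
  let ?from = "\<lambda>g. \<lambda>(\<pi>, i, b)\<in>Bl P. g (\<pi>, i) b"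
  have I: "(\<pi>, i) \<in> ?I \<longleftrightarrow> i < count P \<pi>" for \<pi> i
    by (cases "\<pi> \<in># P") (auto simp: not_in_iff)
  have B: "(\<pi>, i, b) \<in> Bl P \<longleftrightarrow> i < count P \<pi> \<and> b \<in> blocks \<pi>" for \<pi> i b
    by (simp add: Bl_def)
  have "bij_betw ?to ?S (PiE ?I (\<lambda>(\<pi>, i). ?V \<pi>))"
  proof (rule bij_betw_byWitness[where f' = ?from])
    show "\<forall>f\<in>?S. ?from (?to f) = f"
      by (auto simp: fun_eq_iff B I restrict_def PiE_def extensional_def not_in_iff)
    show "\<forall>g\<in>PiE ?I (\<lambda>(\<pi>, i). ?V \<pi>). ?to (?from g) = g"
    proof (rule ballI, rule ext)
      fix g and k :: "ncp \<times> nat" assume g: "g \<in> PiE ?I (\<lambda>(\<pi>, i). ?V \<pi>)"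
      obtain \<pi> i where k: "k = (\<pi>, i)" by (cases k)
      have "?to (?from g) (\<pi>, i) = g (\<pi>, i)"
      proof (cases "i < count P \<pi>")
        case True
        then have "g (\<pi>, i) \<in> ?V \<pi>" using PiE_mem[OF g, of "(\<pi>, i)"] I by auto
        then show ?thesis
          using True I[of \<pi> i] by (auto simp: fun_eq_iff B PiE_def extensional_def restrict_def)
      next
        case False
        then show ?thesis using PiE_arb[OF g, of "(\<pi>, i)"] I[of \<pi> i] by (simp add: restrict_def)
      qed
      then show "?to (?from g) k = g k"
        by (simp only: k)
    qed
    show "?to ` ?S \<subseteq> PiE ?I (\<lambda>(\<pi>, i). ?V \<pi>)"
    proof (intro image_subsetI PiE_I)
      fix f k assume f: "f \<in> ?S" and k: "k \<in> ?I"
      obtain \<pi> i where [simp]: "k = (\<pi>, i)" by (cases k)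
      have i: "i < count P \<pi>" using k I by simp
      have "f (\<pi>, i, b) \<in> {1..n}" if "b \<in> blocks \<pi>" for b
        using f i that B[of \<pi> i b] by (auto dest: PiE_mem)
      then show "?to f k \<in> (case k of (\<pi>, i) \<Rightarrow> ?V \<pi>)"
        using f i k by auto
    qed auto
    show "?from ` PiE ?I (\<lambda>(\<pi>, i). ?V \<pi>) \<subseteq> ?S"
    proof (intro image_subsetI CollectI conjI PiE_I allI impI)
      fix g assume g: "g \<in> PiE ?I (\<lambda>(\<pi>, i). ?V \<pi>)"
      have V: "g (\<pi>, i) \<in> ?V \<pi>" if "i < count P \<pi>" for \<pi> i
        using PiE_mem[OF g, of "(\<pi>, i)"] that I by auto
      show "?from g k \<in> {1..n}" if "k \<in> Bl P" for k
      proof -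
        obtain \<pi> i b where k: "k = (\<pi>, i, b)" by (cases k)
        then have "i < count P \<pi>" "b \<in> blocks \<pi>" using that B by auto
        then show ?thesis using V[of i \<pi>] that k by (auto dest: PiE_mem)
      qed
      show "?from g k = undefined" if "k \<notin> Bl P" for k
        using that by simp
      show "(\<lambda>b\<in>blocks \<pi>. ?from g (\<pi>, i, b)) \<in> W \<pi>" if i: "i < count P \<pi>" for \<pi> i
      proof -
        have "(\<lambda>b\<in>blocks \<pi>. ?from g (\<pi>, i, b)) = g (\<pi>, i)"
          using V[OF i] i by (auto simp: fun_eq_iff B PiE_def extensional_def)
        then show ?thesis using V[OF i] by simp
      qed
    qed
  qed
  then have "card ?S = card (PiE ?I (\<lambda>(\<pi>, i). ?V \<pi>))"
    by (rule bij_betw_same_card)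
  also have "\<dots> = (\<Prod>(\<pi>, i)\<in>?I. card (?V \<pi>))"
    by (subst card_PiE) (auto simp: case_prod_beta)
  also have "\<dots> = (\<Prod>\<pi>\<in>set_mset P. \<Prod>i<count P \<pi>. card (?V \<pi>))"
    by (rule prod.Sigma[symmetric]) auto
  also have "\<dots> = (\<Prod>\<pi>\<in>#P. card (?V \<pi>))"
    by (simp add: image_prod_mset_multiplicity)
  finally show ?thesis .
qed

lemma Bl_le_pairs_iff:
  "(\<forall>x\<in>Bl P. \<forall>y\<in>Bl P. Bl_le x y \<longrightarrow> Q x y) \<longleftrightarrow>
   (\<forall>\<pi> i. i < count P \<pi> \<longrightarrow>
     (\<forall>b\<in>blocks \<pi>. \<forall>c\<in>blocks \<pi>. nest_le b c \<longrightarrow> Q (\<pi>, i, b) (\<pi>, i, c)))"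
  by (auto simp: Bl_def Bl_le_def)

lemma weak_maps_conv:
  "weak_maps P n = {f \<in> Bl P \<rightarrow>\<^sub>E {1..n}. \<forall>\<pi> i. i < count P \<pi> \<longrightarrow>
     (\<lambda>b\<in>blocks \<pi>. f (\<pi>, i, b)) \<in> {g. link_rel (blocks \<pi>) g \<in> Ec \<pi>}}"
  by (simp add: weak_maps_def Bl_le_pairs_iff weak_iff_link_rel[symmetric])

lemma strict_maps_conv:
  "strict_maps P n = {f \<in> Bl P \<rightarrow>\<^sub>E {1..n}. \<forall>\<pi> i. i < count P \<pi> \<longrightarrow>
     (\<lambda>b\<in>blocks \<pi>. f (\<pi>, i, b)) \<in> {g. link_rel (blocks \<pi>) g \<in> flat_relations \<pi>}}"
  by (simp add: strict_maps_def imp_conjL Bl_le_pairs_iff strict_iff_link_rel[symmetric])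

text \<open>
  The common form of the two identities: a character which is the indicator of a set \<open>S \<pi>\<close> of
  contractions corresponds to counting the colourings whose link relation belongs to \<open>S \<pi>\<close>.
\<close>
lemma counting_map_eq_tensor_form:
  fixes \<phi> :: "'k::field_char_0 ncp_alg \<Rightarrow> 'k poly"
  assumes \<phi>: "double_bialgebra_morphism \<phi>"
    and S: "\<And>\<pi>. S \<pi> \<subseteq> Ec \<pi>"
    and g: "\<And>\<pi> E. E \<in> Ec \<pi> \<Longrightarrow>
      (\<Prod>\<rho>\<in>#dot_restr_equiv \<pi> E. g \<rho>) = (if E \<in> S \<pi> then 1 else 0)"
    and c: "\<And>P n. c P n = card {f \<in> Bl P \<rightarrow>\<^sub>E {1..n}. \<forall>\<pi> i. i < count P \<pi> \<longrightarrow>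
      (\<lambda>b\<in>blocks \<pi>. f (\<pi>, i, b)) \<in> {g. link_rel (blocks \<pi>) g \<in> S \<pi>}}"
  shows "counting_map c = tensor_form \<phi> (character g) \<circ> ncp_delta"
proof
  fix x
  have alg: "alg_morphism \<phi>" using \<phi> by (simp add: double_bialgebra_morphism_def)
  let ?T = "\<lambda>\<pi>. \<Sum>E\<in>Ec \<pi>. smult (\<Prod>\<rho>\<in>#dot_restr_equiv \<pi> E. g \<rho>) (\<phi> (mon {#Abs_ncp (quot_blocks \<pi> E)#}))"
  have T: "poly (?T \<pi>) (of_nat n) =
      of_nat (card {f \<in> blocks \<pi> \<rightarrow>\<^sub>E {1..n}. link_rel (blocks \<pi>) f \<in> S \<pi>})" for \<pi> n
  proof -
    have "poly (?T \<pi>) (of_nat n) = (\<Sum>E\<in>Ec \<pi>. if E \<in> S \<pi>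
        then of_nat (card (valid_colourings (quot_blocks \<pi> E) n)) else 0)"
      unfolding poly_sum
      by (intro sum.cong refl)
         (simp add: g poly_morphism_counts_valid_colourings[OF \<phi>] blocks_Abs_quot Ec_def)
    also have "\<dots> = (\<Sum>E\<in>Ec \<pi> \<inter> S \<pi>. of_nat (card (valid_colourings (quot_blocks \<pi> E) n)))"
      by (simp add: sum.inter_restrict[OF finite_Ec])
    also have "Ec \<pi> \<inter> S \<pi> = S \<pi>" using S by blast
    finally show ?thesis by (simp only: card_link_rel_in[OF S] of_nat_sum)
  qed
  have "counting_map c x =
    (\<Sum>P\<in>Poly_Mapping.keys x. smult (Poly_Mapping.lookup x P) (\<Prod>\<pi>\<in>#P. ?T \<pi>))"
  proof (rule counting_map_eqI)
    fix P :: ncp_mon and n :: nat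
    have "poly (\<Prod>\<pi>\<in>#P. ?T \<pi>) (of_nat n) = (\<Prod>\<pi>\<in>#P. poly (?T \<pi>) (of_nat n))"
      by (induction P) (simp_all del: poly_sum)
    also have "\<dots> = of_nat (c P n)"
      unfolding T c card_blockwise_maps by (induction P) simp_all
    finally show "poly (\<Prod>\<pi>\<in>#P. ?T \<pi>) (of_nat n) = of_nat (c P n)" .
  qed
  then show "counting_map c x = (tensor_form \<phi> (character g) \<circ> ncp_delta) x"
    by (simp add: tensor_form_ncp_delta[OF alg])
qed

lemma flat_relations_subset_Ec: "flat_relations \<pi> \<subseteq> Ec \<pi>"
  by (auto simp: flat_relations_def)

theorem corollary4p12:
  fixes \<phi> :: "'k::field_char_0 ncp_alg \<Rightarrow> 'k poly"
  assumes "double_bialgebra_morphism \<phi>"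
  shows "Lambda = tensor_form \<phi> lambda_char \<circ> ncp_delta \<and>
         Lambda_s = tensor_form \<phi> lambda_s_char \<circ> ncp_delta"
proof
  show "Lambda = tensor_form \<phi> lambda_char \<circ> ncp_delta"
    unfolding Lambda_def lambda_char_def
    by (rule counting_map_eq_tensor_form[OF assms, where S = Ec]) (simp_all add: weak_maps_conv)
  show "Lambda_s = tensor_form \<phi> lambda_s_char \<circ> ncp_delta"
    unfolding Lambda_s_def lambda_s_char_def
    by (rule counting_map_eq_tensor_form[OF assms, where S = flat_relations])
       (simp_all add: flat_relations_subset_Ec strict_maps_conv lambda_s_dot_restr_equiv)
qed

end
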